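(* Let $X$ be a real separable Hilbert space, $(T_t)_{t\ge 0}$ a strongly continuous semigroup of bounded linear operators on $X$ with infinitesimal generator $A$, let $b\in X$, let $M$ be a Lévy measure on $X$, and let $(P_t)_{t\ge 0}$ be the generalised Mehler semigroup associated with $(T_t)_{t\ge0}$ and the characteristics $[b,0,M]$. Assume: (1) there is an orthonormal basis $\{h_n\mid n\in\mathbb N\}$ of $X$ consisting of eigenvectors of $A^*$, and $\int_{B_1^c}|x|\,M(dx)<\infty$; (2) the limit $b_\infty:=\lim_{t\to\infty}b_t$ exists in $X$; (3) $\int_0^\infty\int_X(1\wedge|T_sx|^2)\,M(dx)\,ds<\infty$; (4) $\lim_{t\to\infty}T_tx=0$ for every $x\in X$; (5) there is a function $h:(0,\infty)\to(0,\infty)$ with $h\in L^1((0,\infty))$ such that $h(t)M-M\circ T_t^{-1}$ is a positive measure for every $t>0$. Let $\sigma$ be the unique invariant probability measure of $(P_t)_{t\ge0}$ and let $C=\|h\|_{L^1((0,\infty))}$. Then, for every $f\in\mathcal H^2$, $$\|f-m_\sigma(f)\|_{L^2(X,\sigma)}\le\sqrt{2C}\left(\int_X\int_X|f(x+y)-f(x)|^2\,M(dy)\,\sigma(dx)\right)^{1/2}.$$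
   Context: $X$ may be finite or infinite dimensional, with inner product $\langle\cdot,\cdot\rangle$ and norm $|\cdot|$; $X^*$ is identified with $X$; $B_1$ is the open unit ball centred at $0$ and $B_1^c$ its complement. $B_b(X)$ is the space of bounded Borel functions $X\to\mathbb R$. A Lévy measure on $X$ is a Borel measure $M$ with $M(\{0\})=0$ and $\int_X(1\wedge|x|^2)M(dx)<\infty$. For $T\in\mathcal L(X)$, $(M\circ T^{-1})(B)=M(T^{-1}(B))$. Mehler semigroup: set $\lambda(\xi)=-i\langle\xi,b\rangle-\int_X\big(e^{i\langle x,\xi\rangle}-1-i\langle x,\xi\rangle\chi_{B_1}(x)\big)M(dx)$. Standing assumption: $\lambda$ is continuous for the Sazonov topology (the topology generated by the seminorms $x\mapsto|Tx|$, $T$ Hilbert–Schmidt on $X$). For $t\ge0$, $\mu_t$ is the Borel probability measure on $X$ with characteristic function $\widehat{\mu_t}(\xi)=\exp\big(-\int_0^t\lambda(T_s^*\xi)ds\big)$, and $(P_tf)(x)=\int_Xf(T_tx+y)\mu_t(dy)$ for $f\in B_b(X)$. Moreover $$b_t=\int_0^tT_sb\,ds+\int_0^t\int_XT_sx\big(\chi_{B_1}(T_sx)-\chi_{B_1}(x)\big)M(dx)ds.$$ Invariant measure: a Borel probability measure $\sigma$ is invariant if $\int_XP_tf\,d\sigma=\int_Xf\,d\sigma$ for all $t\ge0$, $f\in B_b(X)$. Under (1)–(4) it is known that there is exactly one invariant measure $\sigma$; it is the infinitely divisible law with Lévy–Khinchine characteristics $[b_\infty,0,M_\infty]$, where $M_\infty(\{0\})=0$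 and $M_\infty(B)=\int_0^\infty M(T_s^{-1}(B))ds$ for Borel $B\not\ni0$; also $\mu_t\to\sigma$ weakly as $t\to\infty$. $\mathcal{F}C^2_A(X)$ is the set of functions $F(x)=f(\langle x,h_1\rangle,\dots,\langle x,h_n\rangle)$ with $n\in\mathbb N$ and $f\in C^2_b(\mathbb R^n)$ (bounded with bounded continuous first and second derivatives), $\{h_n\}$ being the basis in (1). $m_\sigma(f)=\int_Xf\,d\sigma$. $\mathcal H^2$ is the Banach space completion of $\mathcal{F}C^2_A(X)$ with respect to the norm $$\|f\|_{\mathcal H^2}=\|f\|_{L^2(X,\sigma)}+\Big(\int_X\int_X|f(x+y)-f(x)|^2M(dy)\sigma(dx)\Big)^{1/2}.$$ For $f\in\mathcal H^2$ represented by a Cauchy sequence $(f_n)\subseteq\mathcal{F}C^2_A(X)$, $f$ as an element of $L^2(X,\sigma)$ means the $L^2(X,\sigma)$-limit of $f_n$, and the double integral of $|f(x+y)-f(x)|^2$ means the limit of the corresponding double integrals for $f_n$. *)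

theory Defs
  imports "HOL-Probability.Probability"
begin

text \<open>
  A real separable Hilbert space is a type of sort
  \<open>{real_inner, banach, polish_space}\<close>; it may be finite or infinite dimensional.
\<close>

section \<open>Semigroups and generators\<close>

definition C0_semigroup :: "(real \<Rightarrow> 'a::real_normed_vector \<Rightarrow> 'a) \<Rightarrow> bool" where
  "C0_semigroup T \<longleftrightarrow>
     (\<forall>t\<ge>0. bounded_linear (T t)) \<and>
     T 0 = id \<and>
     (\<forall>s\<ge>0. \<forall>t\<ge>0. T (s + t) = T s \<circ> T t) \<and>
     (\<forall>x. ((\<lambda>t. T t x) \<longlongrightarrow> x) (at_right 0))"

text \<open>
  Unbounded operators are represented by their graphs. The graph of the adjoint is only meant
  for densely defined operators, which generators of C0-semigroups are.
\<close>

definition generator :: "(real \<Rightarrow> 'a::real_normed_vector \<Rightarrow> 'a) \<Rightarrow> ('a \<times> 'a) set" where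
  "generator T = {(x, y). ((\<lambda>t. (T t x - x) /\<^sub>R t) \<longlongrightarrow> y) (at_right 0)}"

definition adjoint_graph :: "('a::real_inner \<times> 'a) set \<Rightarrow> ('a \<times> 'a) set" where
  "adjoint_graph A = {(u, v). \<forall>(x, y)\<in>A. y \<bullet> u = x \<bullet> v}"

definition eigenvector :: "('a::real_vector \<times> 'a) set \<Rightarrow> 'a \<Rightarrow> bool" where
  "eigenvector A u \<longleftrightarrow> u \<noteq> 0 \<and> (\<exists>c::real. (u, c *\<^sub>R u) \<in> A)"

section \<open>Orthonormal bases, Hilbert--Schmidt operators, Sazonov topology\<close>

definition orthonormal_basis :: "'a::real_inner set \<Rightarrow> bool" where
  "orthonormal_basis B \<longleftrightarrow>
     (\<forall>u\<in>B. norm u = 1) \<and> pairwise orthogonal B \<and> closure (span B) = UNIV"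

text \<open>
  An enumerated orthonormal basis. The index set is all of \<open>nat\<close> if \<open>d = \<infinity>\<close> and
  \<open>{0..<d}\<close> if the space has finite dimension \<open>d\<close>.
\<close>

definition orthonormal_basis_seq :: "enat \<Rightarrow> (nat \<Rightarrow> 'a::real_inner) \<Rightarrow> bool" where
  "orthonormal_basis_seq d e \<longleftrightarrow>
     inj_on e {n. enat n < d} \<and> orthonormal_basis (e ` {n. enat n < d})"

definition hilbert_schmidt :: "('a::real_inner \<Rightarrow> 'a) \<Rightarrow> bool" where
  "hilbert_schmidt S \<longleftrightarrow>
     bounded_linear S \<and> (\<exists>B. orthonormal_basis B \<and> (\<lambda>u. (norm (S u))\<^sup>2) summable_on B)"

definition sazonov :: "'a::real_inner topology" where
  "sazonov = topology_generated_by
     {{y. norm (S (y - x)) < r} | S x r. hilbert_schmidt S \<and> 0 < r}"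

section \<open>The generalised Mehler semigroup\<close>

definition levy_measure :: "'a::real_normed_vector measure \<Rightarrow> bool" where
  "levy_measure M \<longleftrightarrow>
     sets M = sets borel \<and> emeasure M {0} = 0 \<and>
     (\<integral>\<^sup>+x. ennreal (min 1 ((norm x)\<^sup>2)) \<partial>M) < \<infinity>"

definition levy_symbol ::
  "'a::{real_inner,banach,polish_space} \<Rightarrow> 'a measure \<Rightarrow> 'a \<Rightarrow> complex" where
  "levy_symbol b M \<xi> =
     - \<i> * of_real (\<xi> \<bullet> b) -
     (LINT x|M. iexp (x \<bullet> \<xi>) - 1 - \<i> * of_real (x \<bullet> \<xi>) * indicator (ball 0 1) x)"

text \<open>Defining property of the laws \<open>\<mu> t\<close>, through their characteristic functions.\<close>

definition mehler_laws ::
  "(real \<Rightarrow> 'a::{real_inner,banach,polish_space} \<Rightarrow> 'a) \<Rightarrow> 'a \<Rightarrow> 'a measure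
     \<Rightarrow> (real \<Rightarrow> 'a measure) \<Rightarrow> bool" where
  "mehler_laws T b M \<mu> \<longleftrightarrow>
     (\<forall>t\<ge>0. prob_space (\<mu> t) \<and> sets (\<mu> t) = sets borel \<and>
       (\<forall>\<xi>. (LINT x|\<mu> t. iexp (x \<bullet> \<xi>)) =
          exp (- (LINT s:{0..t}|lborel. levy_symbol b M (adjoint (T s) \<xi>)))))"

definition mehler_op ::
  "(real \<Rightarrow> 'a::{real_inner,banach,polish_space} \<Rightarrow> 'a) \<Rightarrow> (real \<Rightarrow> 'a measure)
     \<Rightarrow> real \<Rightarrow> ('a \<Rightarrow> real) \<Rightarrow> 'a \<Rightarrow> real" where
  "mehler_op T \<mu> t f x = (LINT y|\<mu> t. f (T t x + y))"

definition mehler_drift ::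
  "(real \<Rightarrow> 'a::{real_inner,banach,polish_space} \<Rightarrow> 'a) \<Rightarrow> 'a \<Rightarrow> 'a measure \<Rightarrow> real \<Rightarrow> 'a" where
  "mehler_drift T b M t =
     (LINT s:{0..t}|lborel. T s b) +
     (LINT s:{0..t}|lborel. LINT x|M.
        (indicator (ball 0 1) (T s x) - indicator (ball 0 1) x :: real) *\<^sub>R T s x)"

definition invariant_measure ::
  "(real \<Rightarrow> ('a::real_normed_vector \<Rightarrow> real) \<Rightarrow> 'a \<Rightarrow> real) \<Rightarrow> 'a measure \<Rightarrow> bool" where
  "invariant_measure P \<sigma> \<longleftrightarrow>
     prob_space \<sigma> \<and> sets \<sigma> = sets borel \<and>
     (\<forall>t\<ge>0. \<forall>f. f \<in> borel_measurable borel \<and> bounded (range f) \<longrightarrow>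
        (LINT x|\<sigma>. P t f x) = (LINT x|\<sigma>. f x))"

text \<open>
  \<open>K - L\<close> is a positive measure. As both may take the value \<open>\<infinity>\<close>, this is expressed
  as \<open>K = L + N\<close> with a (positive) measure \<open>N\<close>.
\<close>

definition positive_measure_difference :: "'a measure \<Rightarrow> 'a measure \<Rightarrow> bool" where
  "positive_measure_difference K L \<longleftrightarrow>
     (\<exists>N. sets N = sets K \<and> (\<forall>B\<in>sets K. emeasure K B = emeasure L B + emeasure N B))"

section \<open>Cylindrical functions\<close>

text \<open>
  \<open>\<real>\<^sup>n\<close> is the library space \<open>Euclidean_space n\<close>, whose points are the sequences
  vanishing from index \<open>n\<close> on; only the values of functions on these points matter.
\<close>

definition Cb :: "nat \<Rightarrow> ((nat \<Rightarrow> real) \<Rightarrow> real) \<Rightarrow> bool" where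
  "Cb n f \<longleftrightarrow>
     continuous_map (Euclidean_space n) euclideanreal f \<and>
     bounded (f ` topspace (Euclidean_space n))"

definition has_partial_derivative ::
  "nat \<Rightarrow> nat \<Rightarrow> ((nat \<Rightarrow> real) \<Rightarrow> real) \<Rightarrow> ((nat \<Rightarrow> real) \<Rightarrow> real) \<Rightarrow> bool" where
  "has_partial_derivative n i f g \<longleftrightarrow>
     (\<forall>x\<in>topspace (Euclidean_space n).
        ((\<lambda>s. f (x(i := s))) has_real_derivative g x) (at (x i)))"

definition C2b :: "nat \<Rightarrow> ((nat \<Rightarrow> real) \<Rightarrow> real) \<Rightarrow> bool" where
  "C2b n f \<longleftrightarrow> Cb n f \<and>
     (\<exists>f' f''.
        (\<forall>i<n. Cb n (f' i) \<and> has_partial_derivative n i f (f' i)) \<and>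
        (\<forall>i<n. \<forall>j<n. Cb n (f'' i j) \<and> has_partial_derivative n j (f' i) (f'' i j)))"

definition FC2 :: "enat \<Rightarrow> (nat \<Rightarrow> 'a::real_inner) \<Rightarrow> ('a \<Rightarrow> real) set" where
  "FC2 d e =
     {(\<lambda>x. f (\<lambda>i. if i < n then x \<bullet> e i else 0)) | n f. enat n \<le> d \<and> C2b n f}"

section \<open>The space \<open>\<H>\<^sup>2\<close>\<close>

definition square_integrable :: "'a measure \<Rightarrow> ('a \<Rightarrow> real) \<Rightarrow> bool" where
  "square_integrable \<sigma> f \<longleftrightarrow> f \<in> borel_measurable \<sigma> \<and> integrable \<sigma> (\<lambda>x. (f x)\<^sup>2)"

definition L2_norm :: "'a measure \<Rightarrow> ('a \<Rightarrow> real) \<Rightarrow> real" where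
  "L2_norm \<sigma> f = sqrt (LINT x|\<sigma>. (f x)\<^sup>2)"

definition energy :: "'a::ab_group_add measure \<Rightarrow> 'a measure \<Rightarrow> ('a \<Rightarrow> real) \<Rightarrow> real" where
  "energy M \<sigma> f = (LINT x|\<sigma>. LINT y|M. \<bar>f (x + y) - f x\<bar>\<^sup>2)"

definition H2_norm :: "'a::ab_group_add measure \<Rightarrow> 'a measure \<Rightarrow> ('a \<Rightarrow> real) \<Rightarrow> real" where
  "H2_norm M \<sigma> f = L2_norm \<sigma> f + sqrt (energy M \<sigma> f)"

text \<open>
  The completion of \<open>FC2 d e\<close> with respect to \<open>H2_norm M \<sigma>\<close>, as the set of equivalence
  classes of Cauchy sequences modulo null sequences.
\<close>

definition H2_Cauchy ::
  "'a::real_inner measure \<Rightarrow> 'a measure \<Rightarrow> enat \<Rightarrow> (nat \<Rightarrow> 'a) \<Rightarrow> (nat \<Rightarrow> 'a \<Rightarrow> real) set" where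
  "H2_Cauchy M \<sigma> d e =
     {F. (\<forall>n. F n \<in> FC2 d e) \<and>
         (\<forall>\<epsilon>>0. \<exists>N. \<forall>m\<ge>N. \<forall>n\<ge>N. H2_norm M \<sigma> (\<lambda>x. F m x - F n x) < \<epsilon>)}"

definition H2_rel ::
  "'a::real_inner measure \<Rightarrow> 'a measure \<Rightarrow> enat \<Rightarrow> (nat \<Rightarrow> 'a)
     \<Rightarrow> ((nat \<Rightarrow> 'a \<Rightarrow> real) \<times> (nat \<Rightarrow> 'a \<Rightarrow> real)) set" where
  "H2_rel M \<sigma> d e =
     {(F, G). F \<in> H2_Cauchy M \<sigma> d e \<and> G \<in> H2_Cauchy M \<sigma> d e \<and>
              (\<lambda>n. H2_norm M \<sigma> (\<lambda>x. F n x - G n x)) \<longlonglongrightarrow> 0}"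

definition H2 ::
  "'a::real_inner measure \<Rightarrow> 'a measure \<Rightarrow> enat \<Rightarrow> (nat \<Rightarrow> 'a)
     \<Rightarrow> (nat \<Rightarrow> 'a \<Rightarrow> real) set set" where
  "H2 M \<sigma> d e = H2_Cauchy M \<sigma> d e // H2_rel M \<sigma> d e"

text \<open>
  For \<open>f\<close> in the completion: \<open>H2_L2 \<sigma> f u\<close> says that the function \<open>u\<close> represents
  \<open>f\<close> as an element of \<open>L\<^sup>2(\<sigma>)\<close>, and \<open>H2_energy M \<sigma> f\<close> is the extension of
  \<open>energy M \<sigma>\<close> to \<open>f\<close>. Neither depends on the Cauchy sequence chosen in the class.
\<close>

definition H2_L2 ::
  "'a measure \<Rightarrow> (nat \<Rightarrow> 'a \<Rightarrow> real) set \<Rightarrow> ('a \<Rightarrow> real) \<Rightarrow> bool" where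
  "H2_L2 \<sigma> f u \<longleftrightarrow> square_integrable \<sigma> u \<and>
     (\<forall>F\<in>f. (\<lambda>n. L2_norm \<sigma> (\<lambda>x. F n x - u x)) \<longlonglongrightarrow> 0)"

definition H2_energy ::
  "'a::ab_group_add measure \<Rightarrow> 'a measure \<Rightarrow> (nat \<Rightarrow> 'a \<Rightarrow> real) set \<Rightarrow> real" where
  "H2_energy M \<sigma> f = (THE E. \<forall>F\<in>f. (\<lambda>n. energy M \<sigma> (F n)) \<longlonglongrightarrow> E)"

end

theory Submission
  imports Defs "HOL-Real_Asymp.Real_Asymp"
begin

text \<open>
  For a trigonometric polynomial \<open>f\<close> let \<open>V t\<close> be the integral of \<open>(P\<^sub>t f)\<^sup>2\<close> with respect to \<open>\<sigma>\<close>.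
  The Levy-Khinchine formula gives \<open>V' t = - E (P\<^sub>t f)\<close> with the jump energy \<open>E\<close>, and (4) gives
  \<open>V t \<rightarrow> (m\<^sub>\<sigma> f)\<^sup>2\<close> as \<open>t \<rightarrow> \<infinity>\<close>, so the variance of \<open>f\<close> is the integral of \<open>E (P\<^sub>t f)\<close> over all
  \<open>t > 0\<close>. By Jensen's inequality, invariance of \<open>\<sigma>\<close> and (5), \<open>E (P\<^sub>t f) \<le> h t * E f\<close>; hence the
  variance is at most \<open>C * E f\<close>. Cylindrical functions are pointwise limits of trigonometric
  polynomials that are uniformly bounded and uniformly Lipschitz, for which both sides converge.
\<close>

section \<open>Hilbert space preliminaries\<close>

text \<open>Exponentials are the natural test functions because \<open>\<mu> t\<close> is given only
  through its characteristic function, and P_t maps exp(i<x, \<xi>>) to a multiple of exp(i<T_t x,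
  \<xi>>). On a pair of exponentials the energy is governed by \<lambda>(\<xi>) + \<lambda>(\<eta>)
  - \<lambda>(\<xi> + \<eta>), where drift and compensators cancel. Invariance, read as a
  convolution identity for \<sigma>, turns the integral of the product of two evolved exponentials
  into a constant times the exponential of minus the time integral of this expression. So V is
  differentiated without the generator of P_t, its domain, or any smoothness of \<sigma>. The price
  is the passage to cylindrical functions: M integrates only the minimum of 1 and the squared norm,
  so the approximants need sup and Lipschitz bounds that do not depend on the index. Bernstein
  averages supply both. The variance bound has constant C and the norm bound sqrt C, which leaves
  the factor 2 under the root as room to spare.\<close>

lemma uniform_boundedness_seq:
  fixes f :: "nat \<Rightarrow> 'a::banach \<Rightarrow> 'b::real_normed_vector"
  assumes lin: "\<And>n. bounded_linear (f n)"
    and bdd: "\<And>x. bounded (range (\<lambda>n. f n x))"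
  shows "\<exists>K\<ge>0. \<forall>n x. norm (f n x) \<le> K * norm x"
proof -
  \<comment> \<open>Baire argument: the closed sets \<open>S k\<close> cover the space, so one of
    them contains a ball. Small vectors are differences of two points of that ball, which doubles
    the bound \<open>k\<close>.\<close>
  define S where "S k = {x. \<forall>n. norm (f n x) \<le> real k}" for k :: nat
  have closed: "closed (S k)" for k
  proof -
    have "S k = (\<Inter>n. {x. norm (f n x) \<le> real k})" by (auto simp: S_def)
    moreover have "closed {x. norm (f n x) \<le> real k}" for n
      by (intro closed_Collect_le continuous_intros bounded_linear.continuous_on[OF lin])
    ultimately show ?thesis by auto
  qed
  have "x \<in> \<Union>(range S)" for x
  proof -
    obtain B where "\<And>n. norm (f n x) \<le> B"
      using bdd[of x] by (auto simp: bounded_iff)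
    moreover obtain k :: nat where "B \<le> real k" using real_arch_simple by blast
    ultimately show ?thesis by (auto simp: S_def intro!: exI[of _ k] intro: order_trans)
  qed
  then have "\<Union>(range S) = UNIV" by blast
  moreover have "interior (\<Union>(range S)) = {}" if "\<And>k. interior (S k) = {}"
  proof -
    have "Met_TC.mtopology interior_of \<Union>(range S) = {}"
      by (rule Met_TC.metric_Baire_category_alt)
         (use that closed in \<open>simp_all add: complete_UNIV image_iff, blast?\<close>)
    then show ?thesis by simp
  qed
  ultimately obtain k where "interior (S k) \<noteq> {}" by auto
  then obtain x r where r: "r > 0" "ball x r \<subseteq> S k"
    by (meson all_not_in_conv mem_interior)
  have small: "norm (f n y) \<le> 2 * real k" if "norm y < r" for n y
  proof -
    have "x \<in> S k" "x + y \<in> S k" using r that by (auto simp: dist_norm)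
    then have "norm (f n x) \<le> k" "norm (f n (x + y)) \<le> k" by (auto simp: S_def)
    moreover have "f n y = f n (x + y) - f n x"
      using lin[of n] by (simp add: linear_simps)
    ultimately show ?thesis by (metis add_mono mult_2 norm_triangle_le_diff)
  qed
  have "norm (f n y) \<le> (4 * real k / r) * norm y" for n y
  proof (cases "y = 0")
    case True
    then show ?thesis using lin[of n] by (simp add: linear_simps)
  next
    case False
    \<comment> \<open>Scaling to norm \<open>r / 2\<close> brings \<open>y\<close> into the reach of
      \<open>small\<close>; this accounts for the constant \<open>4 * k / r\<close>.\<close>
    let ?c = "r / (2 * norm y)"
    have "norm (f n (?c *\<^sub>R y)) \<le> 2 * real k" using False r by (intro small) simp
    moreover have "f n (?c *\<^sub>R y) = ?c *\<^sub>R f n y" using lin[of n] by (simp add: linear_simps)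
    ultimately have "?c * norm (f n y) \<le> 2 * real k" using r by simp
    then show ?thesis using False r by (simp add: field_simps)
  qed
  then show ?thesis using r by (intro exI[of _ "4 * real k / r"]) auto
qed

text \<open>Direct method: \<open>\<phi>\<close> is represented by the minimiser of the quadratic
  functional \<open>J\<close>. Completing the square bounds \<open>J\<close> from below, and
  vanishing of the first variation at the minimiser is the representation.\<close>

lemma riesz_representation:
  fixes \<phi> :: "'a::{real_inner,banach} \<Rightarrow> real"
  assumes "bounded_linear \<phi>"
  shows "\<exists>v. \<forall>x. \<phi> x = x \<bullet> v"
proof -
  interpret bounded_linear \<phi> by fact
  define J where "J x = (norm x)\<^sup>2 / 2 - \<phi> x" for x
  obtain K where K: "K > 0" "\<And>x. norm (\<phi> x) \<le> norm x * K" using pos_bounded by blast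
  have "- K\<^sup>2 / 2 \<le> J x" for x
  proof -
    have "0 \<le> (norm x - K)\<^sup>2" by simp
    then show ?thesis using K(2)[of x] by (auto simp: J_def power2_eq_square algebra_simps)
  qed
  then have bdd: "bdd_below (range J)" by (intro bdd_belowI[of _ "- K\<^sup>2 / 2"]) auto
  define m where "m = Inf (range J)"
  have m_le: "m \<le> J x" for x unfolding m_def by (rule cInf_lower[OF _ bdd]) simp
  have "\<exists>x. J x < m + 1 / real (Suc n)" for n
    using cInf_lessD[of "range J" "m + 1 / real (Suc n)"] by (auto simp: m_def)
  then obtain x where x: "\<And>n. J (x n) < m + 1 / real (Suc n)" by metis
  \<comment> \<open>Parallelogram law: near-minimisers are close to each other because
    \<open>J\<close> at their midpoint is still at least \<open>m\<close>.\<close>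
  have par: "(norm (y - z))\<^sup>2 / 4 \<le> J y + J z - 2 * m" for y z
  proof -
    have "J y + J z - 2 * J ((1/2) *\<^sub>R (y + z)) = (norm (y - z))\<^sup>2 / 4"
      by (simp add: J_def add scaleR power2_norm_eq_inner inner_simps inner_commute field_simps)
    then show ?thesis using m_le[of "(1/2) *\<^sub>R (y + z)"] by linarith
  qed
  have "Cauchy x"
  proof (rule CauchyI)
    fix \<epsilon> :: real assume "\<epsilon> > 0"
    \<comment> \<open>By \<open>par\<close> the squared distance is below 4 times the two excesses 1
      / (N + 1), that is 8 / (N + 1).\<close>
    then obtain N where N: "8 / \<epsilon>\<^sup>2 < real N" using reals_Archimedean2 by blast
    have "norm (x i - x j) < \<epsilon>" if "i \<ge> N" "j \<ge> N" for i j
    proof -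
      have "1 / real (Suc i) \<le> 1 / real (Suc N)" "1 / real (Suc j) \<le> 1 / real (Suc N)"
        using that by (auto intro!: frac_le)
      then have "(norm (x i - x j))\<^sup>2 / 4 < 2 / real (Suc N)"
        using par[of "x i" "x j"] x[of i] x[of j] by linarith
      also have "\<dots> \<le> \<epsilon>\<^sup>2 / 4"
      proof -
        have "8 < real N * \<epsilon>\<^sup>2" using N \<open>\<epsilon> > 0\<close> by (simp add: field_simps)
        then have "8 \<le> (1 + real N) * \<epsilon>\<^sup>2"
          using zero_le_power2[of \<epsilon>] unfolding distrib_right by linarith
        then show ?thesis by (simp add: field_simps)
      qed
      finally show ?thesis using \<open>\<epsilon> > 0\<close> by (intro power2_less_imp_less[of _ \<epsilon>]) auto
    qed
    then show "\<exists>N. \<forall>i\<ge>N. \<forall>j\<ge>N. norm (x i - x j) < \<epsilon>" by blast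
  qed
  then obtain v where v: "x \<longlonglongrightarrow> v" using Cauchy_convergent_iff convergent_def by blast
  have "(\<lambda>n. J (x n)) \<longlonglongrightarrow> J v"
    unfolding J_def by (intro tendsto_intros tendsto v) simp
  moreover have "(\<lambda>n. m + 1 / real (Suc n)) \<longlonglongrightarrow> m + 0"
    by (intro tendsto_intros LIMSEQ_Suc[OF lim_1_over_n])
  ultimately have "J v \<le> m"
    using x by (intro LIMSEQ_le[of "\<lambda>n. J (x n)" _ "\<lambda>n. m + 1 / real (Suc n)"]) (auto intro: less_imp_le)
  have "\<phi> w = w \<bullet> v" for w
  proof -
    define c where "c = v \<bullet> w - \<phi> w"
    have ge: "0 \<le> s * c + s\<^sup>2 * ((norm w)\<^sup>2 / 2)" for s
    proof -
      have "J (v + s *\<^sub>R w) = J v + s * c + s\<^sup>2 * ((norm w)\<^sup>2 / 2)"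
        by (simp add: J_def c_def add scaleR power2_norm_eq_inner inner_simps inner_commute
            power2_eq_square[of s] algebra_simps add_divide_distrib)
      then show ?thesis using m_le[of "v + s *\<^sub>R w"] \<open>J v \<le> m\<close> by linarith
    qed
    \<comment> \<open>The optimal \<open>s\<close> would be \<open>- c\<close> over the squared norm
      of \<open>w\<close>; adding 1 to the denominator covers \<open>w = 0\<close>, and the value at
      \<open>- c / q\<close> still forces \<open>c = 0\<close>.\<close>
    define q where "q = (norm w)\<^sup>2 + 1"
    have q: "q > 0" by (simp add: q_def add_nonneg_pos)
    have "0 \<le> (- c / q) * c + (- c / q)\<^sup>2 * ((q - 1) / 2)"
      using ge[of "- c / q"] by (simp add: q_def)
    also have "\<dots> = - c\<^sup>2 * (q + 1) / (2 * q\<^sup>2)"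
      using q by (simp add: field_simps power2_eq_square)
    finally have "c\<^sup>2 * (q + 1) / (2 * q\<^sup>2) \<le> 0" by simp
    then have "c\<^sup>2 * (q + 1) \<le> 0" using q by (simp add: divide_le_0_iff)
    then have "c\<^sup>2 \<le> 0" using q by (simp add: mult_le_0_iff)
    then have "c = 0" by simp
    then show ?thesis by (simp add: c_def inner_commute)
  qed
  then show ?thesis by blast
qed

text \<open>\<open>adjoint\<close> is a choice, so its defining equation holds once some adjoint
  exists; Riesz representation yields one, vector by vector.\<close>

lemma inner_adjoint:
  fixes S :: "'a::{real_inner,banach} \<Rightarrow> 'b::real_inner"
  assumes "bounded_linear S"
  shows "x \<bullet> adjoint S y = S x \<bullet> y"
proof -
  have "\<exists>v. \<forall>x. S x \<bullet> y = x \<bullet> v" for y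
    by (intro riesz_representation bounded_linear_intros assms)
  then obtain g where "\<And>x y. S x \<bullet> y = x \<bullet> g y" by metis
  then have "\<exists>g. \<forall>x y. S x \<bullet> y = x \<bullet> g y" by blast
  then have "\<forall>x y. S x \<bullet> y = x \<bullet> adjoint S y" unfolding adjoint_def by (rule someI_ex)
  then show ?thesis by simp
qed

section \<open>Strongly continuous semigroups\<close>

text \<open>If every bound fails, there are times \<open>s n\<close> tending to 0 along which the
  operator norms blow up, although strong continuity bounds each orbit. This contradicts uniform
  boundedness, for which a sequence of operators is enough.\<close>

lemma C0_semigroup_bounded_near_0:
  fixes T :: "real \<Rightarrow> 'a::banach \<Rightarrow> 'a"
  assumes "C0_semigroup T"
  shows "\<exists>\<delta>>0. \<exists>K\<ge>0. \<forall>s\<in>{0..\<delta>}. \<forall>x. norm (T s x) \<le> K * norm x"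
proof (rule ccontr)
  assume neg: "\<not> ?thesis"
  have "\<exists>p. fst p \<in> {0..1 / real (Suc n)} \<and> real n * norm (snd p) < norm (T (fst p) (snd p))" for n
  proof -
    have "1 / real (Suc n) > 0" "real n \<ge> 0" by simp_all
    with neg have "\<not> (\<forall>s\<in>{0..1 / real (Suc n)}. \<forall>x. norm (T s x) \<le> real n * norm x)" by blast
    then obtain s x where "s \<in> {0..1 / real (Suc n)}" "\<not> norm (T s x) \<le> real n * norm x" by blast
    then show ?thesis unfolding not_le by (intro exI[of _ "(s, x)"]) (simp only: fst_conv snd_conv simp_thms)
  qed
  then have "\<exists>p. \<forall>n. fst (p n) \<in> {0..1 / real (Suc n)}
      \<and> real n * norm (snd (p n)) < norm (T (fst (p n)) (snd (p n)))"
    by (intro choice allI)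
  then obtain p where p: "\<And>n. fst (p n) \<in> {0..1 / real (Suc n)}
      \<and> real n * norm (snd (p n)) < norm (T (fst (p n)) (snd (p n)))"
    by (auto simp only:)
  define s y where "s n = fst (p n)" and "y n = snd (p n)" for n
  have s: "s n \<in> {0..1 / real (Suc n)}" and y: "real n * norm (y n) < norm (T (s n) (y n))" for n
    using p[of n] by (simp_all only: s_def y_def)
  have lin: "bounded_linear (T t)" if "t \<ge> 0" for t
    using assms that by (auto simp: C0_semigroup_def)
  have "s \<longlonglongrightarrow> 0"
  proof (rule tendsto_sandwich[OF _ _ tendsto_const LIMSEQ_Suc[OF lim_1_over_n]])
    show "\<forall>\<^sub>F n in sequentially. 0 \<le> s n" "\<forall>\<^sub>F n in sequentially. s n \<le> 1 / real (Suc n)"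
      using s unfolding atLeastAtMost_iff by (intro always_eventually allI; blast)+
  qed
  have "bounded (range (\<lambda>n. T (s n) x))" for x
  proof -
    have "(T 0 x) = x" "((\<lambda>t. T t x) \<longlongrightarrow> x) (at_right 0)"
      using assms by (auto simp: C0_semigroup_def)
    \<comment> \<open>The times \<open>s n\<close> may equal 0, so the limit from the right is
      recast as continuity at 0 within the closed half-line.\<close>
    then have "continuous (at 0 within {0..}) (\<lambda>t. T t x)"
      unfolding continuous_within at_within_Ici_at_right by (simp only:)
    moreover have "s n \<in> {0..}" for n using s[of n] unfolding atLeastAtMost_iff atLeast_iff by blast
    ultimately have "(\<lambda>n. T (s n) x) \<longlonglongrightarrow> T 0 x"
      using \<open>s \<longlonglongrightarrow> 0\<close>
      by (rule continuous_within_tendsto_compose'[where f = "\<lambda>t. T t x" and x = s and F = sequentially])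
    then show ?thesis by (rule convergent_imp_bounded)
  qed
  moreover have "bounded_linear (T (s n))" for n using s[of n] by (intro lin) simp
  ultimately have "\<exists>K\<ge>0. \<forall>n x. norm (T (s n) x) \<le> K * norm x"
    by (intro uniform_boundedness_seq)
  then obtain K where K: "\<And>n x. norm (T (s n) x) \<le> K * norm x" by blast
  obtain n :: nat where "K \<le> real n" using real_arch_simple by blast
  then have "norm (T (s n) (y n)) \<le> real n * norm (y n)"
    using K by (meson mult_right_mono norm_ge_zero order_trans)
  with y[of n] show False by simp
qed

text \<open>By the semigroup law each further stretch of length \<open>\<delta>\<close> costs one
  factor, and finitely many stretches cover the interval.\<close>

lemma C0_semigroup_locally_bounded:
  fixes T :: "real \<Rightarrow> 'a::banach \<Rightarrow> 'a"
  assumes "C0_semigroup T"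
  shows "\<exists>K\<ge>1. \<forall>s\<in>{0..t}. \<forall>x. norm (T s x) \<le> K * norm x"
proof -
  obtain \<delta> K where \<delta>: "\<delta> > 0" and K: "\<And>s x. s \<in> {0..\<delta>} \<Longrightarrow> norm (T s x) \<le> K * norm x"
    using C0_semigroup_bounded_near_0[OF assms] by blast
  have add: "T (s + r) x = T s (T r x)" if "s \<ge> 0" "r \<ge> 0" for s r x
    using assms that by (simp add: C0_semigroup_def)
  \<comment> \<open>Raising the factor to at least 1 makes its powers increase, so the bound for the
    longest time also serves the shorter ones.\<close>
  define L where "L = max K 1"
  have L1: "L \<ge> 1" by (simp add: L_def)
  have L: "norm (T s x) \<le> L * norm x" if "s \<in> {0..\<delta>}" for s x
    by (rule order_trans[OF K[OF that, of x] mult_right_mono]) (simp_all add: L_def)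
  have pow: "norm (T s x) \<le> L ^ Suc n * norm x" if "s \<in> {0..real (Suc n) * \<delta>}" for n s x
    using that
  proof (induction n arbitrary: s)
    case 0
    then show ?case using L by simp
  next
    case (Suc n)
    show ?case
    proof (cases "s \<le> real (Suc n) * \<delta>")
      case True
      then have "norm (T s x) \<le> L ^ Suc n * norm x" using Suc by simp
      also have "\<dots> \<le> L ^ Suc (Suc n) * norm x"
        using L1 by (intro mult_right_mono power_increasing) auto
      finally show ?thesis .
    next
      case False
      have *: "s - \<delta> \<in> {0..real (Suc n) * \<delta>}"
      proof -
        have "s \<le> real n * \<delta> + 2 * \<delta>" "real n * \<delta> + \<delta> < s" "0 \<le> real n * \<delta>"
          using Suc.prems False \<delta> by (simp_all add: algebra_simps)
        then have "0 \<le> s - \<delta>" "s - \<delta> \<le> real n * \<delta> + \<delta>" using \<delta> by linarith+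
        then show ?thesis by (simp add: algebra_simps)
      qed
      then have "norm (T s x) = norm (T \<delta> (T (s - \<delta>) x))"
        using add[of \<delta> "s - \<delta>" x] \<delta> by simp
      also have "\<dots> \<le> L * norm (T (s - \<delta>) x)" using L \<delta> by simp
      also have "\<dots> \<le> L * (L ^ Suc n * norm x)"
        using Suc.IH[OF *] by (intro mult_left_mono) (auto simp: L_def)
      finally show ?thesis by (simp add: mult_ac)
    qed
  qed
  obtain n :: nat where "t / \<delta> \<le> real n" using real_arch_simple by blast
  then have "t \<le> real (Suc n) * \<delta>" using \<delta> by (simp add: field_simps)
  moreover have "1 \<le> L ^ Suc n" by (intro one_le_power) (simp add: L_def)
  ultimately show ?thesis
    using pow[of _ n] by (intro exI[of _ "L ^ Suc n"]) auto
qed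

text \<open>Splitting off the smaller of the two times reduces continuity from either side to the
  behaviour of one orbit at 0 and the local bound for the operators.\<close>

lemma C0_semigroup_continuous_on:
  fixes T :: "real \<Rightarrow> 'a::banach \<Rightarrow> 'a"
  assumes "C0_semigroup T"
  shows "continuous_on {0..} (\<lambda>s. T s x)"
proof -
  have lin: "bounded_linear (T t)" if "t \<ge> 0" for t
    using assms that by (auto simp: C0_semigroup_def)
  have add: "T (s + r) x = T s (T r x)" if "s \<ge> 0" "r \<ge> 0" for s r x
    using assms that by (simp add: C0_semigroup_def)
  have "\<exists>\<delta>>0. \<forall>s\<in>{0..}. \<bar>s - t\<bar> < \<delta> \<longrightarrow> norm (T s x - T t x) < \<epsilon>" if t: "t \<ge> 0" and \<epsilon>: "\<epsilon> > 0" for t \<epsilon>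
  proof -
    obtain K where K: "K \<ge> 1" "\<And>s x. s \<in> {0..t+1} \<Longrightarrow> norm (T s x) \<le> K * norm x"
      using C0_semigroup_locally_bounded[OF assms, of "t + 1"] by blast
    have "((\<lambda>t. T t x) \<longlongrightarrow> x) (at_right 0)" using assms by (auto simp: C0_semigroup_def)
    then have "\<forall>\<^sub>F r in at_right 0. dist (T r x) x < \<epsilon> / K"
      using \<epsilon> K(1) by (intro tendstoD) auto
    then obtain \<delta> where \<delta>: "\<delta> > 0" "\<And>r. 0 < r \<Longrightarrow> r < \<delta> \<Longrightarrow> norm (T r x - x) < \<epsilon> / K"
      by (auto simp: eventually_at_right_field dist_norm)
    have *: "norm (T (s + r) x - T s x) < \<epsilon>" if "s \<ge> 0" "s \<le> t + 1" "0 \<le> r" "r < \<delta>" for s r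
    proof (cases "r = 0")
      case False
      have "norm (T (s + r) x - T s x) = norm (T s (T r x - x))"
        using that lin[of s] by (simp add: add linear_simps)
      also have "\<dots> \<le> K * norm (T r x - x)" using that by (intro K) auto
      also have "\<dots> < K * (\<epsilon> / K)" using that False K(1) by (intro mult_strict_left_mono \<delta>) auto
      finally show ?thesis using K(1) by simp
    qed (use \<epsilon> in simp)
    have "norm (T s x - T t x) < \<epsilon>" if "s \<ge> 0" "\<bar>s - t\<bar> < \<delta>" for s
    proof (cases "t \<le> s")
      case True
      then show ?thesis using *[of t "s - t"] that t by simp
    next
      case False
      then show ?thesis using *[of s "t - s"] that t by (simp add: norm_minus_commute)
    qed
    then show ?thesis using \<delta>(1) by auto
  qed
  then show ?thesis by (auto simp: continuous_on_iff dist_norm abs_minus_commute)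
qed

section \<open>Exponential sums\<close>

text \<open>The inductive form makes closure under products a double induction. Coefficients are
  complex so that sines belong to the class.\<close>

inductive_set exp_sums :: "('a::real_inner \<Rightarrow> complex) set" where
  single: "(\<lambda>x. c * iexp (x \<bullet> \<xi>)) \<in> exp_sums"
| add: "f \<in> exp_sums \<Longrightarrow> g \<in> exp_sums \<Longrightarrow> (\<lambda>x. f x + g x) \<in> exp_sums"

lemma exp_sums_const: "(\<lambda>x. c) \<in> exp_sums"
  using exp_sums.single[of c 0] by simp

lemma exp_sums_mult_single: "f \<in> exp_sums \<Longrightarrow> (\<lambda>x. f x * (c * iexp (x \<bullet> \<xi>))) \<in> exp_sums"
proof (induction rule: exp_sums.induct)
  case (single c' \<xi>')
  have "(\<lambda>x. c' * iexp (x \<bullet> \<xi>') * (c * iexp (x \<bullet> \<xi>))) = (\<lambda>x. (c' * c) * iexp (x \<bullet> (\<xi>' + \<xi>)))"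
    by (simp add: fun_eq_iff inner_add_right exp_add algebra_simps)
  then show ?case using exp_sums.single by simp
next
  case (add f g)
  then show ?case using exp_sums.add[OF add.IH] by (simp add: distrib_right)
qed

lemma exp_sums_mult: "g \<in> exp_sums \<Longrightarrow> f \<in> exp_sums \<Longrightarrow> (\<lambda>x. f x * g x) \<in> exp_sums"
proof (induction rule: exp_sums.induct)
  case (single c \<xi>)
  then show ?case by (rule exp_sums_mult_single)
next
  case (add g1 g2)
  then show ?case using exp_sums.add[OF add.IH] by (simp add: distrib_left)
qed

text \<open>Returns to an indexed finite sum, over which integrals, derivatives and limits are later
  taken term by term. Frequencies may repeat, so addition is concatenation.\<close>

lemma exp_sums_expand:
  "f \<in> exp_sums \<Longrightarrow> \<exists>n c \<xi>. \<forall>x. f x = (\<Sum>i<n::nat. c i * iexp (x \<bullet> \<xi> i))"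
proof (induction rule: exp_sums.induct)
  case (single c \<xi>)
  show ?case by (rule exI[of _ 1], rule exI[of _ "\<lambda>_. c"], rule exI[of _ "\<lambda>_. \<xi>"]) simp
next
  case (add f g)
  from add.IH(1) obtain n c \<xi> where f: "\<forall>x. f x = (\<Sum>i<n::nat. c i * iexp (x \<bullet> \<xi> i))" by fast
  from add.IH(2) obtain m c' \<xi>' where g: "\<forall>x. g x = (\<Sum>i<m::nat. c' i * iexp (x \<bullet> \<xi>' i))" by fast
  define d where "d i = (if i < n then c i else c' (i - n))" for i
  define \<zeta> where "\<zeta> i = (if i < n then \<xi> i else \<xi>' (i - n))" for i
  have "f x + g x = (\<Sum>i<n + m. d i * iexp (x \<bullet> \<zeta> i))" for x
  proof -
    have "(\<Sum>i<n + m. d i * iexp (x \<bullet> \<zeta> i)) =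
        (\<Sum>i<n. d i * iexp (x \<bullet> \<zeta> i)) + (\<Sum>i<m. d (n + i) * iexp (x \<bullet> \<zeta> (n + i)))"
      by (induction m) (simp_all add: add_ac)
    then show ?thesis unfolding f[rule_format] g[rule_format] d_def \<zeta>_def by simp
  qed
  then show ?case by blast
qed

definition trig_poly :: "('a::real_inner \<Rightarrow> real) \<Rightarrow> bool" where
  "trig_poly f \<longleftrightarrow> (\<lambda>x. complex_of_real (f x)) \<in> exp_sums"

lemma trig_poly_const: "trig_poly (\<lambda>x. c)"
  by (simp add: trig_poly_def exp_sums_const)

lemma trig_poly_add: "trig_poly f \<Longrightarrow> trig_poly g \<Longrightarrow> trig_poly (\<lambda>x. f x + g x)"
  unfolding trig_poly_def of_real_add by (rule exp_sums.add)

lemma trig_poly_mult: "trig_poly f \<Longrightarrow> trig_poly g \<Longrightarrow> trig_poly (\<lambda>x. f x * g x)"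
  unfolding trig_poly_def of_real_mult by (rule exp_sums_mult)

lemma trig_poly_sin: "trig_poly (\<lambda>x. sin (x \<bullet> \<xi> / r))"
proof -
  have "complex_of_real (sin (x \<bullet> \<xi> / r)) =
    1 / (2 * \<i>) * iexp (x \<bullet> (\<xi> /\<^sub>R r)) + (- 1 / (2 * \<i>)) * iexp (x \<bullet> (- \<xi> /\<^sub>R r))" for x
  proof -
    have "complex_of_real (sin z) = 1 / (2 * \<i>) * iexp z + (- 1 / (2 * \<i>)) * iexp (- z)" for z
    proof -
      have "complex_of_real (sin z) = sin (complex_of_real z)" by (simp only: sin_of_real)
      also have "\<dots> = (exp (\<i> * complex_of_real z) - exp (- (\<i> * complex_of_real z))) / (2 * \<i>)"
        by (rule sin_exp_eq)
      finally show ?thesis by (simp add: diff_divide_distrib algebra_simps)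
    qed
    moreover have "x \<bullet> (\<xi> /\<^sub>R r) = x \<bullet> \<xi> / r" "x \<bullet> (- \<xi> /\<^sub>R r) = - (x \<bullet> \<xi> / r)"
      by (simp_all add: divide_inverse mult.commute)
    ultimately show ?thesis by (simp only:)
  qed
  then have "(\<lambda>x. complex_of_real (sin (x \<bullet> \<xi> / r))) =
    (\<lambda>x. 1 / (2 * \<i>) * iexp (x \<bullet> (\<xi> /\<^sub>R r)) + (- 1 / (2 * \<i>)) * iexp (x \<bullet> (- \<xi> /\<^sub>R r)))"
    by (rule ext)
  then show ?thesis
    unfolding trig_poly_def by (simp only:) (intro exp_sums.intros)
qed

section \<open>Averages along binomial random walks\<close>

text \<open>
  \<open>walk_avg p \<delta> g N a\<close> is the expectation of \<open>g (a + \<delta> S)\<close> for a binomial variable \<open>S\<close> with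
  parameters \<open>N\<close> and \<open>p\<close>. As a function of \<open>p\<close> it is a Bernstein polynomial.
\<close>

primrec walk_avg :: "real \<Rightarrow> real \<Rightarrow> (real \<Rightarrow> real) \<Rightarrow> nat \<Rightarrow> real \<Rightarrow> real" where
  "walk_avg p \<delta> g 0 a = g a"
| "walk_avg p \<delta> g (Suc N) a = p * walk_avg p \<delta> g N (a + \<delta>) + (1 - p) * walk_avg p \<delta> g N a"

text \<open>One step of \<open>walk_avg\<close> is a convex combination, so this is the induction
  step of the distance estimates below.\<close>

lemma convex_comb_dist:
  fixes p :: real
  assumes "p \<in> {0..1}" "\<bar>u - u'\<bar> \<le> B" "\<bar>v - v'\<bar> \<le> B"
  shows "\<bar>(p * u + (1 - p) * v) - (p * u' + (1 - p) * v')\<bar> \<le> B"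
proof -
  have "(p * u + (1 - p) * v) - (p * u' + (1 - p) * v') = p * (u - u') + (1 - p) * (v - v')"
    by (simp add: algebra_simps)
  also have "\<bar>\<dots>\<bar> \<le> p * \<bar>u - u'\<bar> + (1 - p) * \<bar>v - v'\<bar>"
    using assms(1) by (intro order_trans[OF abs_triangle_ineq]) (simp add: abs_mult)
  also have "\<dots> \<le> p * B + (1 - p) * B"
    using assms by (intro add_mono mult_left_mono) auto
  finally show ?thesis by (simp add: algebra_simps)
qed

lemma walk_avg_const: "walk_avg p \<delta> (\<lambda>_. c) N a = c"
  by (induction N arbitrary: a) (simp_all add: algebra_simps)

lemma walk_avg_mono:
  assumes "p \<in> {0..1}" "\<And>v. g v \<le> g' v"
  shows "walk_avg p \<delta> g N a \<le> walk_avg p \<delta> g' N a"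
  using assms by (induction N arbitrary: a) (auto intro!: add_mono mult_left_mono)

lemma walk_avg_affine:
  "walk_avg p \<delta> (\<lambda>v. u * g v + w) N a = u * walk_avg p \<delta> g N a + w"
  by (induction N arbitrary: a) (simp_all add: algebra_simps)

lemma walk_avg_dist:
  assumes "p \<in> {0..1}" "\<And>v. \<bar>g v - g' v\<bar> \<le> B"
  shows "\<bar>walk_avg p \<delta> g N a - walk_avg p \<delta> g' N a\<bar> \<le> B"
  using assms(2) by (induction N arbitrary: a) (auto intro!: convex_comb_dist assms(1) simp: assms(2))

lemma walk_avg_shift:
  assumes "p \<in> {0..1}" "\<And>s t. \<bar>g s - g t\<bar> \<le> L * \<bar>s - t\<bar>"
  shows "\<bar>walk_avg p \<delta> g N a - walk_avg p \<delta> g N a'\<bar> \<le> L * \<bar>a - a'\<bar>"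
proof (induction N arbitrary: a a')
  case (Suc N)
  show ?case
    using Suc[of "a + \<delta>" "a' + \<delta>"] Suc[of a a'] unfolding walk_avg.simps
    by (intro convex_comb_dist assms(1)) simp_all
qed (simp add: assms)

text \<open>Changing the parameter in a single step costs its change times the difference between
  neighbouring starting points, at most \<open>L * \<delta>\<close>; the \<open>N\<close> costs add
  up.\<close>

lemma walk_avg_lipschitz_param:
  assumes p: "p \<in> {0..1}" "q \<in> {0..1}" and g: "\<And>s t. \<bar>g s - g t\<bar> \<le> L * \<bar>s - t\<bar>" and "\<delta> \<ge> 0"
  shows "\<bar>walk_avg p \<delta> g N a - walk_avg q \<delta> g N a\<bar> \<le> real N * \<delta> * L * \<bar>p - q\<bar>"
proof (induction N arbitrary: a)
  case (Suc N)
  let ?P = "walk_avg p \<delta> g N" and ?Q = "walk_avg q \<delta> g N"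
  have "walk_avg p \<delta> g (Suc N) a - walk_avg q \<delta> g (Suc N) a =
      ((p * ?P (a + \<delta>) + (1 - p) * ?P a) - (p * ?Q (a + \<delta>) + (1 - p) * ?Q a)) +
      (p - q) * (?Q (a + \<delta>) - ?Q a)"
    by (simp add: algebra_simps)
  also have "\<bar>\<dots>\<bar> \<le> real N * \<delta> * L * \<bar>p - q\<bar> + \<bar>p - q\<bar> * (L * \<bar>a + \<delta> - a\<bar>)"
    unfolding abs_mult
    by (intro order_trans[OF abs_triangle_ineq] add_mono convex_comb_dist Suc p, unfold abs_mult)
      (intro mult_left_mono walk_avg_shift p g abs_ge_zero)
  finally show ?case using \<open>\<delta> \<ge> 0\<close> by (simp add: algebra_simps)
qed simp

text \<open>Squared bias plus variance of a binomial walk with mean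
  \<open>a + N * p * \<delta>\<close>.\<close>

lemma walk_avg_square:
  "walk_avg p \<delta> (\<lambda>v. (v - c)\<^sup>2) N a = (a + real N * p * \<delta> - c)\<^sup>2 + real N * p * (1 - p) * \<delta>\<^sup>2"
proof (induction N arbitrary: a)
  case (Suc N)
  show ?case unfolding walk_avg.simps Suc by (simp add: algebra_simps power2_eq_square)
qed simp

text \<open>Bernstein's argument: |z| is at most z^2 / \<epsilon> + \<epsilon>, the first term
  winning beyond \<epsilon> and the second below it. The linear modulus of continuity is thus
  controlled by the second moment, which is explicit.\<close>

lemma walk_avg_approx:
  assumes p: "p \<in> {0..1}" and g: "\<And>s t. \<bar>g s - g t\<bar> \<le> L * \<bar>s - t\<bar>" and "\<epsilon> > 0"
    and c: "c = a + real N * p * \<delta>"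
  shows "\<bar>walk_avg p \<delta> g N a - g c\<bar> \<le> L * (\<epsilon> + real N * p * (1 - p) * \<delta>\<^sup>2 / \<epsilon>)"
proof -
  have L: "L \<ge> 0" using g[of 1 0] by simp
  have *: "\<bar>g v - g c\<bar> \<le> L / \<epsilon> * (v - c)\<^sup>2 + L * \<epsilon>" for v
  proof -
    have "\<bar>z\<bar> \<le> z\<^sup>2 / \<epsilon> + \<epsilon>" for z
    proof (cases "\<bar>z\<bar> \<le> \<epsilon>")
      case False
      then have "\<bar>z\<bar> * \<epsilon> \<le> \<bar>z\<bar> * \<bar>z\<bar>" by (intro mult_left_mono) auto
      then have "\<bar>z\<bar> \<le> z\<^sup>2 / \<epsilon>" using \<open>\<epsilon> > 0\<close> by (simp add: field_simps power2_eq_square)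
      then show ?thesis using \<open>\<epsilon> > 0\<close> by simp
    qed (use \<open>\<epsilon> > 0\<close> in \<open>simp add: add_increasing\<close>)
    then have "L * \<bar>v - c\<bar> \<le> L * ((v - c)\<^sup>2 / \<epsilon> + \<epsilon>)" using L by (intro mult_left_mono)
    then show ?thesis using g[of v c] by (simp add: algebra_simps)
  qed
  let ?q = "\<lambda>v. L / \<epsilon> * (v - c)\<^sup>2 + L * \<epsilon>"
  \<comment> \<open>The factors 1 and -1 bring the upper and the lower bound into the form of
    \<open>walk_avg_affine\<close>.\<close>
  have "walk_avg p \<delta> g N a \<le> walk_avg p \<delta> (\<lambda>v. 1 * ?q v + g c) N a"
    "walk_avg p \<delta> (\<lambda>v. (-1) * ?q v + g c) N a \<le> walk_avg p \<delta> g N a"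
    using * by (intro walk_avg_mono p; simp add: abs_le_iff algebra_simps; smt (verit))+
  then have "\<bar>walk_avg p \<delta> g N a - g c\<bar> \<le> walk_avg p \<delta> ?q N a"
    unfolding walk_avg_affine[of p \<delta> _ ?q] by (simp add: abs_le_iff)
  also have "\<dots> = L * (\<epsilon> + real N * p * (1 - p) * \<delta>\<^sup>2 / \<epsilon>)"
    unfolding walk_avg_affine walk_avg_square c by (simp add: distrib_left)
  finally show ?thesis .
qed

text \<open>For fixed \<open>N\<close> the average is a polynomial in the parameter and in finitely
  many values of \<open>g\<close>, and trigonometric polynomials form an algebra.\<close>

lemma trig_poly_walk_avg:
  assumes "trig_poly p" "\<And>v. trig_poly (g v)"
  shows "trig_poly (\<lambda>x. walk_avg (p x) \<delta> (\<lambda>v. g v x) N a)"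
proof (induction N arbitrary: a)
  case (Suc N)
  have "trig_poly (\<lambda>x. 1 + (-1) * p x)"
    by (intro trig_poly_add trig_poly_mult trig_poly_const assms)
  then show ?case
    unfolding walk_avg.simps by (intro trig_poly_add trig_poly_mult assms Suc) simp
qed (simp add: assms)

section \<open>Approximation of cylindrical functions\<close>

lemma lipschitz_borel_measurable:
  fixes g :: "'a::real_normed_vector \<Rightarrow> real"
  assumes "\<And>x y. \<bar>g (x + y) - g x\<bar> \<le> K * norm y"
  shows "g \<in> borel_measurable borel"
proof (rule borel_measurable_continuous_onI, rule lipschitz_on_continuous_on)
  \<comment> \<open>On the zero space the hypothesis admits a negative \<open>K\<close>, whereas
    \<open>lipschitz_on\<close> wants a nonnegative constant.\<close>
  have "\<bar>g x - g y\<bar> \<le> max K 0 * norm (x - y)" for x y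
    using order_trans[OF assms[of y "x - y"] mult_right_mono[of K "max K 0"]] by simp
  then show "(max K 0)-lipschitz_on UNIV g"
    by (intro lipschitz_onI) (simp_all add: dist_norm)
qed

text \<open>The condition is imposed one coordinate at a time because the arguments are unrestricted
  sequences without a norm, and because operators acting on a single coordinate preserve it with the
  same \<open>L\<close>.\<close>

definition coord_lipschitz :: "real \<Rightarrow> ((nat \<Rightarrow> real) \<Rightarrow> real) \<Rightarrow> bool" where
  "coord_lipschitz L G \<longleftrightarrow> (\<forall>x i s t. \<bar>G (x(i := s)) - G (x(i := t))\<bar> \<le> L * \<bar>s - t\<bar>)"

text \<open>
  The Bernstein operator of degree \<open>m\<^sup>4\<close> on \<open>[-m, m]\<close> in the \<open>i\<close>-th coordinate, evaluated at
  \<open>m sin (x\<^sub>i / m)\<close>. This substitution turns polynomials into trigonometric polynomials, tends to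
  the identity as \<open>m \<rightarrow> \<infinity>\<close> and does not increase Lipschitz constants.
\<close>

definition bernstein_sin :: "nat \<Rightarrow> nat \<Rightarrow> ((nat \<Rightarrow> real) \<Rightarrow> real) \<Rightarrow> (nat \<Rightarrow> real) \<Rightarrow> real" where
  "bernstein_sin m i G x =
     walk_avg ((1 + sin (x i / m)) / 2) (2 / real m ^ 3) (\<lambda>v. G (x(i := v))) (m ^ 4) (- real m)"

lemma sin_param_range: "(1 + sin z) / 2 \<in> {0..1::real}"
proof -
  have "0 \<le> 1 + sin z" using sin_ge_minus_one[of z] by linarith
  then show ?thesis by simp
qed

lemma bernstein_sin_bounded:
  assumes "\<And>x. \<bar>G x\<bar> \<le> K"
  shows "\<bar>bernstein_sin m i G x\<bar> \<le> K"
  using walk_avg_dist[OF sin_param_range, of "\<lambda>v. G (x(i := v))" "\<lambda>_. 0" K] assms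
  by (simp add: bernstein_sin_def walk_avg_const)

lemma sin_dist_le: "\<bar>sin s - sin t\<bar> \<le> \<bar>s - t\<bar>" for s t :: real
proof -
  have "\<bar>sin s - sin t\<bar> \<le> 1 * \<bar>s - t\<bar>"
    using field_differentiable_bound[of UNIV sin cos 1 s t]
    by (auto simp: DERIV_sin abs_cos_le_one intro: has_field_derivative_at_within)
  then show ?thesis by simp
qed

text \<open>In coordinate \<open>i\<close> the scales cancel: steps times step size is 2m, the
  parameter halves it, and the sine of s / m contributes 1 / m. In any other coordinate the value is
  an average of \<open>L\<close>-Lipschitz functions.\<close>

lemma bernstein_sin_lipschitz:
  assumes G: "coord_lipschitz L G" and m: "m > 0"
  shows "coord_lipschitz L (bernstein_sin m i G)"
  unfolding coord_lipschitz_def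
proof (intro allI)
  fix x j s t
  have G': "\<bar>G (y(k := u)) - G (y(k := v))\<bar> \<le> L * \<bar>u - v\<bar>" for y k u v
    using G by (simp add: coord_lipschitz_def)
  have L: "L \<ge> 0" using G'[of undefined 0 1 0] by simp
  show "\<bar>bernstein_sin m i G (x(j := s)) - bernstein_sin m i G (x(j := t))\<bar> \<le> L * \<bar>s - t\<bar>"
  proof (cases "j = i")
    case True
    let ?p = "(1 + sin (s / m)) / 2" and ?q = "(1 + sin (t / m)) / 2"
    have "\<bar>bernstein_sin m i G (x(j := s)) - bernstein_sin m i G (x(j := t))\<bar>
        \<le> real (m ^ 4) * (2 / real m ^ 3) * L * \<bar>?p - ?q\<bar>"
      unfolding bernstein_sin_def True fun_upd_upd fun_upd_same
      by (intro walk_avg_lipschitz_param sin_param_range G') simp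
    also have "\<dots> = L * (m * \<bar>sin (s / m) - sin (t / m)\<bar>)"
      using m by (simp add: field_simps eval_nat_numeral diff_divide_distrib[symmetric])
    also have "\<dots> \<le> L * (m * \<bar>s / m - t / m\<bar>)"
      by (intro mult_left_mono sin_dist_le L) simp
    also have "m * \<bar>s / m - t / m\<bar> = \<bar>s - t\<bar>"
      using m by (simp add: diff_divide_distrib[symmetric])
    finally show ?thesis .
  next
    case False
    have "(x(j := s))(i := v) = (x(i := v))(j := s)" for s v
      using False by (rule fun_upd_twist)
    then show ?thesis
      unfolding bernstein_sin_def
      using False by (auto intro!: walk_avg_dist sin_param_range G' simp del: fun_upd_apply simp: fun_upd_other)
  qed
qed

definition sin_error :: "nat \<Rightarrow> real \<Rightarrow> real" where
  "sin_error m s = 5 / m + \<bar>m * sin (s / m) - s\<bar>"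

lemma bernstein_sin_error:
  assumes G: "coord_lipschitz L G" and m: "m > 0"
  shows "\<bar>bernstein_sin m i G x - G x\<bar> \<le> L * sin_error m (x i)"
proof -
  have G': "\<bar>G (y(k := u)) - G (y(k := v))\<bar> \<le> L * \<bar>u - v\<bar>" for y k u v
    using G by (simp add: coord_lipschitz_def)
  have L: "L \<ge> 0" using G'[of undefined 0 1 0] by simp
  let ?p = "(1 + sin (x i / m)) / 2"
  have p: "?p \<in> {0..1}" by (rule sin_param_range)
  define c where "c = m * sin (x i / m)"
  have "c = - real m + real (m ^ 4) * ?p * (2 / real m ^ 3)"
    using m by (simp add: c_def field_simps eval_nat_numeral)
  \<comment> \<open>The walk has mean \<open>c\<close>. With \<epsilon> = 1 / m the variance term is
    4 p (1 - p) / m, so the total stays below 5 / m; moving from \<open>c\<close> to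
    \<open>x i\<close> gives the other part of \<open>sin_error\<close>.\<close>
  then have "\<bar>bernstein_sin m i G x - G (x(i := c))\<bar> \<le>
      L * (1 / m + real (m ^ 4) * ?p * (1 - ?p) * (2 / real m ^ 3)\<^sup>2 / (1 / m))"
    unfolding bernstein_sin_def using m by (intro walk_avg_approx p G') auto
  also have "\<dots> \<le> L * (5 / m)"
  proof (intro mult_left_mono L)
    have "?p * (1 - ?p) \<le> 1 * 1" using p by (intro mult_mono) auto
    then have "4 / m * (?p * (1 - ?p)) \<le> 4 / m" 
      by (intro mult_left_le) auto
    moreover have "real (m ^ 4) * ?p * (1 - ?p) * (2 / real m ^ 3)\<^sup>2 / (1 / m) = 4 / m * (?p * (1 - ?p))"
    proof -
      have "real (m ^ 4) * q * r * (2 / real m ^ 3)\<^sup>2 / (1 / m) = 4 / m * (q * r)" for q r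
        using m by (simp add: field_simps eval_nat_numeral)
      then show ?thesis .
    qed
    ultimately show "1 / m + real (m ^ 4) * ?p * (1 - ?p) * (2 / real m ^ 3)\<^sup>2 / (1 / m) \<le> 5 / m"
      by (simp add: field_simps)
  qed
  finally have "\<bar>bernstein_sin m i G x - G (x(i := c))\<bar> \<le> L * (5 / m)" .
  moreover have "\<bar>G (x(i := c)) - G x\<bar> \<le> L * \<bar>c - x i\<bar>"
    using G'[of x i c "x i"] by simp
  ultimately show ?thesis
    unfolding sin_error_def c_def distrib_left by linarith
qed

lemma sin_error_tendsto: "(\<lambda>m. sin_error (Suc m) s) \<longlonglongrightarrow> 0"
proof -
  have "((\<lambda>r. r * sin (s / r) - s) \<longlongrightarrow> 0) at_top" by real_asymp
  then have "(\<lambda>m. real (Suc m) * sin (s / real (Suc m)) - s) \<longlonglongrightarrow> 0"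
    by (rule filterlim_compose)
      (intro filterlim_compose[OF filterlim_real_sequentially] filterlim_Suc)
  moreover have "(\<lambda>m. 5 / real (Suc m)) \<longlonglongrightarrow> 0"
    by (intro LIMSEQ_Suc lim_const_over_n)
  ultimately show ?thesis
    unfolding sin_error_def using tendsto_add tendsto_rabs by fastforce
qed

primrec bernstein_sins :: "nat \<Rightarrow> nat \<Rightarrow> ((nat \<Rightarrow> real) \<Rightarrow> real) \<Rightarrow> (nat \<Rightarrow> real) \<Rightarrow> real" where
  "bernstein_sins m 0 G = G"
| "bernstein_sins m (Suc n) G = bernstein_sin m n (bernstein_sins m n G)"

lemma bernstein_sins_bounded:
  "(\<And>x. \<bar>G x\<bar> \<le> K) \<Longrightarrow> \<bar>bernstein_sins m n G x\<bar> \<le> K"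
  by (induction n arbitrary: x) (simp_all add: bernstein_sin_bounded)

lemma bernstein_sins_lipschitz:
  "coord_lipschitz L G \<Longrightarrow> m > 0 \<Longrightarrow> coord_lipschitz L (bernstein_sins m n G)"
  by (induction n) (simp_all add: bernstein_sin_lipschitz)

text \<open>Telescoping over the coordinates; the constant \<open>L\<close> does not grow because
  every operator preserves it.\<close>

lemma bernstein_sins_error:
  assumes "coord_lipschitz L G" "m > 0"
  shows "\<bar>bernstein_sins m n G x - G x\<bar> \<le> L * (\<Sum>i<n. sin_error m (x i))"
proof (induction n)
  case (Suc n)
  have "\<bar>bernstein_sins m (Suc n) G x - bernstein_sins m n G x\<bar> \<le> L * sin_error m (x n)"
    using bernstein_sin_error[OF bernstein_sins_lipschitz[OF assms, of n] assms(2)] by simp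
  then show ?case using Suc unfolding sum.lessThan_Suc distrib_left by linarith
qed simp

lemma bernstein_sins_tendsto:
  assumes "coord_lipschitz L G"
  shows "(\<lambda>m. bernstein_sins (Suc m) n G x) \<longlonglongrightarrow> G x"
proof -
  have "(\<lambda>m. L * (\<Sum>i<n. sin_error (Suc m) (x i))) \<longlonglongrightarrow> L * (\<Sum>i<n. 0)"
    by (intro tendsto_intros sin_error_tendsto)
  then have lim: "(\<lambda>m. L * (\<Sum>i<n. sin_error (Suc m) (x i))) \<longlonglongrightarrow> 0" by simp
  have "norm (bernstein_sins (Suc m) n G x - G x) \<le> L * (\<Sum>i<n. sin_error (Suc m) (x i))" for m
    unfolding real_norm_def by (rule bernstein_sins_error[OF assms]) simp
  then have "(\<lambda>m. bernstein_sins (Suc m) n G x - G x) \<longlonglongrightarrow> 0"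
    using lim by (rule Lim_null_comparison[OF always_eventually[OF allI]])
  then show ?thesis by (simp add: LIM_zero_iff)
qed

text \<open>The tail \<open>z\<close> is arbitrary for the sake of the induction: once coordinate
  \<open>n\<close> is frozen at a node \<open>v\<close>, it belongs to the tail of the induction
  hypothesis.\<close>

lemma trig_poly_bernstein_sins:
  fixes e :: "nat \<Rightarrow> 'a::real_inner"
  shows "trig_poly (\<lambda>x. bernstein_sins m n G (\<lambda>i. if i < n then x \<bullet> e i else z i))"
proof (induction n arbitrary: z)
  case (Suc n)
  have upd: "(\<lambda>i. if i < Suc n then x \<bullet> e i else z i)(n := v) =
      (\<lambda>i. if i < n then x \<bullet> e i else (z(n := v)) i)" for x v
    by (auto simp: fun_eq_iff)
  have "trig_poly (\<lambda>x. 1 / 2 + 1 / 2 * sin (x \<bullet> e n / m))"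
    by (intro trig_poly_add trig_poly_mult trig_poly_const trig_poly_sin)
  then have "trig_poly (\<lambda>x. (1 + sin (x \<bullet> e n / m)) / 2)"
    by (simp add: add_divide_distrib)
  then show ?case
    unfolding bernstein_sins.simps bernstein_sin_def upd
    by (simp del: fun_upd_apply add: trig_poly_walk_avg Suc)
qed (simp add: trig_poly_const)

section \<open>Trigonometric approximation of cylindrical functions with uniform bounds\<close>

lemma coord_lipschitz_dist:
  assumes "coord_lipschitz L G"
  shows "\<bar>G (\<lambda>i. if i < n then u i else z i) - G (\<lambda>i. if i < n then v i else z i)\<bar>
    \<le> L * (\<Sum>i<n. \<bar>u i - v i\<bar>)"
proof (induction n arbitrary: z)
  case (Suc n)
  have upd: "(\<lambda>i. if i < Suc n then w i else z i) = (\<lambda>i. if i < n then w i else (z(n := w n)) i)" for w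
    by (auto simp: fun_eq_iff)
  have upd': "(\<lambda>i. if i < n then v i else (z(n := w)) i) = (\<lambda>i. if i < n then v i else z i)(n := w)" for w
    by (auto simp: fun_eq_iff)
  have "\<bar>G (\<lambda>i. if i < n then v i else (z(n := u n)) i) - G (\<lambda>i. if i < n then v i else (z(n := v n)) i)\<bar>
      \<le> L * \<bar>u n - v n\<bar>"
    unfolding upd' using assms by (auto simp: coord_lipschitz_def simp del: fun_upd_apply)
  then show ?case
    using Suc[of "z(n := u n)"] unfolding upd sum.lessThan_Suc distrib_left by linarith
qed simp

text \<open>Only the values of \<open>f\<close> at sequences vanishing from \<open>n\<close> on are
  meaningful, so \<open>G\<close> first cuts off the tail and is then defined for all sequences. Its
  Lipschitz bound is the mean value theorem with bounded first derivatives.\<close>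

lemma C2b_extension:
  assumes "C2b n f"
  defines "G \<equiv> \<lambda>x. f (\<lambda>i. if i < n then x i else 0)"
  shows "\<exists>K. \<forall>x. \<bar>G x\<bar> \<le> K" "\<exists>L. coord_lipschitz L G"
proof -
  let ?E = "topspace (Euclidean_space n)"
  have E: "(\<lambda>i. if i < n then x i else 0) \<in> ?E" for x :: "nat \<Rightarrow> real"
    by (simp add: topspace_Euclidean_space)
  have bdd: "\<exists>B. \<forall>x\<in>?E. \<bar>g x\<bar> \<le> B" if "Cb n g" for g
    using that by (auto simp: Cb_def bounded_iff)
  from assms have f: "Cb n f" by (simp add: C2b_def)
  show "\<exists>K. \<forall>x. \<bar>G x\<bar> \<le> K" using bdd[OF f] E unfolding G_def by blast
  from assms obtain f' where f': "\<And>i. i < n \<Longrightarrow> Cb n (f' i)" "\<And>i. i < n \<Longrightarrow> has_partial_derivative n i f (f' i)"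
    unfolding C2b_def by blast
  have "\<forall>i. \<exists>B. i < n \<longrightarrow> (\<forall>x\<in>?E. \<bar>f' i x\<bar> \<le> B)" using bdd f'(1) by blast
  then obtain B where B: "\<And>i x. i < n \<Longrightarrow> x \<in> ?E \<Longrightarrow> \<bar>f' i x\<bar> \<le> B i"
    unfolding choice_iff by blast
  \<comment> \<open>A sum of absolute values serves as a common bound for the finitely many partial
    derivatives, and is 0 when there are none.\<close>
  define L where "L = (\<Sum>i<n. \<bar>B i\<bar>)"
  have L: "\<bar>f' i x\<bar> \<le> L" if "i < n" "x \<in> ?E" for i x
  proof -
    have "\<bar>B i\<bar> \<le> L" unfolding L_def using that by (intro member_le_sum) auto
    then show ?thesis using B[OF that] by linarith
  qed
  have "\<bar>G (x(i := s)) - G (x(i := t))\<bar> \<le> L * \<bar>s - t\<bar>" for x i s t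
  proof (cases "i < n")
    case True
    define y where "y r = (\<lambda>j. if j < n then (x(i := r)) j else 0)" for r
    have y: "y r \<in> ?E" "y r i = r" "(y r)(i := q) = y q" for r q
      using True E[of "x(i := r)"] by (auto simp: y_def fun_eq_iff)
    have "((\<lambda>q. f (y q)) has_real_derivative f' i (y r)) (at r)" for r
    proof -
      have "((\<lambda>q. f ((y r)(i := q))) has_real_derivative f' i (y r)) (at (y r i))"
        using f'(2)[OF True] y(1)[of r] unfolding has_partial_derivative_def by blast
      then show ?thesis unfolding y(2,3) .
    qed
    then have "norm (f (y s) - f (y t)) \<le> L * norm (s - t)"
      using L[OF True y(1)]
      by (intro field_differentiable_bound[of UNIV _ "\<lambda>r. f' i (y r)"]) auto
    then show ?thesis by (simp add: G_def y_def)
  next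
    case False
    then have "(\<lambda>j. if j < n then (x(i := r)) j else 0) = (\<lambda>j. if j < n then x j else 0)" for r
      by (auto simp: fun_eq_iff)
    then show ?thesis by (simp add: G_def L_def sum_nonneg)
  qed
  then show "\<exists>L. coord_lipschitz L G" by (auto simp: coord_lipschitz_def)
qed

text \<open>The point is that \<open>K\<close> does not depend on \<open>m\<close>: squared
  increments are then dominated by one multiple of the integrand that M integrates.\<close>

lemma FC2_trig_poly_approx:
  fixes F :: "'a::real_inner \<Rightarrow> real"
  assumes "F \<in> FC2 d e"
  obtains g K where "\<And>m. trig_poly (g m)" "\<And>m x. \<bar>g m x\<bar> \<le> K"
    "\<And>m x y. \<bar>g m (x + y) - g m x\<bar> \<le> K * norm y" "\<And>x. (\<lambda>m. g m x) \<longlonglongrightarrow> F x"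
proof -
  from assms obtain n f where F: "F = (\<lambda>x. f (\<lambda>i. if i < n then x \<bullet> e i else 0))" and f: "C2b n f"
    by (auto simp: FC2_def)
  define G where "G x = f (\<lambda>i. if i < n then x i else 0)" for x
  obtain K L where K: "\<And>x. \<bar>G x\<bar> \<le> K" and L: "coord_lipschitz L G"
    using C2b_extension[OF f] unfolding G_def[abs_def] by blast
  define c where "c x i = (if i < n then x \<bullet> e i else 0)" for x i
  have F': "F x = G (c x)" for x unfolding F G_def c_def by (rule arg_cong[of _ _ f]) auto
  define g where "g m x = bernstein_sins (Suc m) n G (c x)" for m x
  \<comment> \<open>One constant for both bounds; the sum comes from Cauchy-Schwarz in each
    coordinate \<open>x \<bullet> e i\<close>.\<close>
  define K' where "K' = max K (L * (\<Sum>i<n. norm (e i)))"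
  have L0: "L \<ge> 0" using L[unfolded coord_lipschitz_def, rule_format, of undefined 0 1 0] by simp
  show ?thesis
  proof (rule that)
    show "trig_poly (g m)" for m
      unfolding g_def c_def by (rule trig_poly_bernstein_sins)
    show "\<bar>g m x\<bar> \<le> K'" for m x
      unfolding g_def K'_def using bernstein_sins_bounded[of G K] K by (simp add: le_max_iff_disj)
    show "\<bar>g m (x + y) - g m x\<bar> \<le> K' * norm y" for m x y
    proof -
      have "\<bar>g m (x + y) - g m x\<bar> \<le> L * (\<Sum>i<n. \<bar>(x + y) \<bullet> e i - x \<bullet> e i\<bar>)"
        unfolding g_def c_def by (intro coord_lipschitz_dist bernstein_sins_lipschitz L) simp
      also have "\<dots> \<le> L * (\<Sum>i<n. norm (e i) * norm y)"
        using Cauchy_Schwarz_ineq2[of y]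
        by (intro mult_left_mono sum_mono L0) (simp add: inner_add_left mult.commute[of _ "norm y"])
      also have "\<dots> \<le> K' * norm y"
        unfolding sum_distrib_right[symmetric] mult.assoc[symmetric]
        by (intro mult_right_mono) (simp_all add: K'_def)
      finally show ?thesis .
    qed
    show "(\<lambda>m. g m x) \<longlonglongrightarrow> F x" for x
      unfolding g_def F' by (rule bernstein_sins_tendsto[OF L])
  qed
qed

lemma FC2_bounds:
  assumes "F \<in> FC2 d e"
  shows "\<exists>K. (\<forall>x. \<bar>F x\<bar> \<le> K) \<and> (\<forall>x y. \<bar>F (x + y) - F x\<bar> \<le> K * norm y)"
proof -
  obtain g K where g: "\<And>m x. \<bar>g m x\<bar> \<le> K" "\<And>m x y. \<bar>g m (x + y) - g m x\<bar> \<le> K * norm y"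
    and lim: "\<And>x. (\<lambda>m::nat. g m x) \<longlonglongrightarrow> F x"
    by (rule FC2_trig_poly_approx[OF assms]) blast
  have "\<bar>F x\<bar> \<le> K" for x
    by (rule LIMSEQ_le_const2[OF tendsto_rabs[OF lim]]) (use g in auto)
  moreover have "\<bar>F (x + y) - F x\<bar> \<le> K * norm y" for x y
    by (rule LIMSEQ_le_const2[OF tendsto_rabs[OF tendsto_diff[OF lim lim]]]) (use g in auto)
  ultimately show ?thesis by blast
qed

section \<open>Mehler semigroups of pure jump type\<close>

lemma (in prob_space) square_expectation_le:
  fixes X :: "'a \<Rightarrow> real"
  assumes "integrable M X" "integrable M (\<lambda>x. (X x)\<^sup>2)"
  shows "(expectation X)\<^sup>2 \<le> expectation (\<lambda>x. (X x)\<^sup>2)"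
  using variance_eq[OF assms] variance_positive[of X] by simp

lemma norm_iexp_diff_le: "norm (iexp a - 1) \<le> \<bar>a\<bar>"
  using iexp_approx1[of a 0] by simp

lemma norm_iexp_diff_le_2: "norm (iexp a - 1) \<le> 2"
  using norm_triangle_ineq4[of "iexp a" 1] by simp

lemma integrable_iexp_inner:
  fixes S :: "'a::topological_space \<Rightarrow> 'b::{real_inner,second_countable_topology}"
  assumes "finite_measure N" "sets N = sets borel" "S \<in> borel_measurable borel"
  shows "integrable N (\<lambda>x. iexp (S x \<bullet> \<xi>))"
proof -
  interpret finite_measure N by fact
  have [measurable_cong]: "sets N = sets borel" by fact
  have [measurable]: "S \<in> borel_measurable borel" by fact
  show ?thesis by (rule integrable_const_bound[of _ 1]) simp_all
qed

lemma levy_measure_integrable_min: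
  assumes "levy_measure M"
  shows "integrable M (\<lambda>x. min 1 ((norm x)\<^sup>2))"
proof (rule integrableI_nonneg)
  have [measurable_cong]: "sets M = sets borel" using assms by (simp add: levy_measure_def)
  show "(\<lambda>x. min 1 ((norm x)\<^sup>2)) \<in> borel_measurable M" by measurable
qed (use assms in \<open>auto simp: levy_measure_def\<close>)

text \<open>Markov's inequality gives finite mass to the sets where the integrable weight is at
  least 1 / (n + 1); together with the origin they exhaust the space. This makes Fubini available
  for \<open>\<sigma>\<close> and \<open>M\<close>.\<close>

lemma levy_measure_sigma_finite:
  assumes "levy_measure M"
  shows "sigma_finite_measure M"
proof
  have sets[measurable_cong]: "sets M = sets borel" using assms by (simp add: levy_measure_def)
  have space: "space M = UNIV" using sets_eq_imp_space_eq[OF sets] by simp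
  define A where "A n = {x::'a. 1 / real (Suc n) \<le> min 1 ((norm x)\<^sup>2)}" for n
  have A: "A n \<in> sets M" for n unfolding sets A_def by measurable
  have fin: "emeasure M (A n) \<noteq> \<infinity>" for n
  proof -
    have "emeasure M (A n) = (\<integral>\<^sup>+x. indicator (A n) x \<partial>M)" using A by simp
    also have "\<dots> \<le> (\<integral>\<^sup>+x. ennreal (real (Suc n)) * ennreal (min 1 ((norm x)\<^sup>2)) \<partial>M)"
    proof (rule nn_integral_mono)
      fix x
      show "indicator (A n) x \<le> ennreal (real (Suc n)) * ennreal (min 1 ((norm x)\<^sup>2))"
      proof (cases "x \<in> A n")
        case True
        then have "1 \<le> real (Suc n) * min 1 ((norm x)\<^sup>2)"
          by (simp only: A_def mem_Collect_eq) (simp add: field_simps)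
        then have "ennreal 1 \<le> ennreal (real (Suc n) * min 1 ((norm x)\<^sup>2))" by (rule ennreal_leI)
        also have "\<dots> = ennreal (real (Suc n)) * ennreal (min 1 ((norm x)\<^sup>2))" by (rule ennreal_mult) simp_all
        finally show ?thesis using True by simp
      qed simp
    qed
    also have "\<dots> = ennreal (real (Suc n)) * (\<integral>\<^sup>+x. ennreal (min 1 ((norm x)\<^sup>2)) \<partial>M)"
      by (intro nn_integral_cmult) measurable
    also have "\<dots> < \<infinity>" using assms by (simp add: levy_measure_def ennreal_mult_less_top)
    finally show ?thesis by simp
  qed
  have cover: "\<Union>(insert {0} (range A)) = space M"
  proof -
    have "\<exists>n. x \<in> A n" if "x \<noteq> 0" for x
    proof -
      have "min 1 ((norm x)\<^sup>2) > 0" using that by simp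
      then obtain n where "inverse (real (Suc n)) < min 1 ((norm x)\<^sup>2)" using reals_Archimedean by blast
      then have "x \<in> A n" unfolding A_def mem_Collect_eq inverse_eq_divide by (rule less_imp_le)
      then show ?thesis by blast
    qed
    then show ?thesis unfolding space by blast
  qed
  have "emeasure M {0} \<noteq> \<infinity>" using assms by (simp add: levy_measure_def)
  then show "\<exists>A. countable A \<and> A \<subseteq> sets M \<and> \<Union>A = space M \<and> (\<forall>a\<in>A. emeasure M a \<noteq> \<infinity>)"
    using A fin cover sets by (intro exI[of _ "insert {0} (range A)"]) auto
qed

locale levy_mehler =
  fixes T :: "real \<Rightarrow> 'a::{real_inner,banach,polish_space} \<Rightarrow> 'a"
    and b :: 'a and M :: "'a measure" and \<mu> :: "real \<Rightarrow> 'a measure" and \<sigma> :: "'a measure"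
  assumes semigroup: "C0_semigroup T"
    and levy: "levy_measure M"
    and laws: "mehler_laws T b M \<mu>"
    and invariant: "invariant_measure (mehler_op T \<mu>) \<sigma>"
begin

lemma sets_M[simp, measurable_cong]: "sets M = sets borel"
  using levy by (simp add: levy_measure_def)

lemma sets_\<sigma>[simp, measurable_cong]: "sets \<sigma> = sets borel"
  using invariant by (simp add: invariant_measure_def)

lemma sets_\<mu>: "t \<ge> 0 \<Longrightarrow> sets (\<mu> t) = sets borel"
  using laws by (simp add: mehler_laws_def)

lemma prob_\<mu>: "t \<ge> 0 \<Longrightarrow> prob_space (\<mu> t)"
  using laws by (simp add: mehler_laws_def)

sublocale \<sigma>: prob_space \<sigma>
  using invariant by (simp add: invariant_measure_def)

sublocale M: sigma_finite_measure M
  by (rule levy_measure_sigma_finite[OF levy])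

sublocale \<sigma>M: pair_sigma_finite \<sigma> M ..

lemma T_linear: "t \<ge> 0 \<Longrightarrow> bounded_linear (T t)"
  using semigroup by (simp add: C0_semigroup_def)

lemma T_measurable: "t \<ge> 0 \<Longrightarrow> T t \<in> borel_measurable borel"
  by (intro borel_measurable_continuous_onI linear_continuous_on T_linear)

lemma T_add: "t \<ge> 0 \<Longrightarrow> T t (x + y) = T t x + T t y"
  using T_linear[of t] by (simp add: linear_simps)

lemma T_locally_bounded: "\<exists>K\<ge>1. \<forall>s\<in>{0..t}. \<forall>x. norm (T s x) \<le> K * norm x"
  by (rule C0_semigroup_locally_bounded[OF semigroup])

lemma T_continuous: "continuous_on {0..} (\<lambda>s. T s x)"
  by (rule C0_semigroup_continuous_on[OF semigroup])

lemma integrable_M_bound: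
  fixes g :: "'a \<Rightarrow> 'b::{banach,second_countable_topology}"
  assumes "g \<in> borel_measurable borel" "\<And>x. norm (g x) \<le> K * min 1 ((norm x)\<^sup>2)"
  shows "integrable M g"
proof (rule Bochner_Integration.integrable_bound)
  show "integrable M (\<lambda>x. K * min 1 ((norm x)\<^sup>2))"
    by (intro integrable_mult_right levy_measure_integrable_min levy)
  show "AE x in M. norm (g x) \<le> norm (K * min 1 ((norm x)\<^sup>2))"
    using order_trans[OF assms(2) abs_ge_self] by (simp add: AE_I2)
qed (use assms in measurable)

text \<open>Dominated convergence along sequences of times, with one dominating function for the
  whole interval.\<close>

lemma continuous_on_integral_M:
  fixes G :: "real \<Rightarrow> 'a \<Rightarrow> complex"
  assumes meas: "\<And>s. s \<ge> 0 \<Longrightarrow> G s \<in> borel_measurable borel"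
    and bound: "\<And>s x. s \<in> {0..t} \<Longrightarrow> norm (G s x) \<le> K * min 1 ((norm x)\<^sup>2)"
    and cont: "\<And>x. continuous_on {0..} (\<lambda>s. G s x)"
  shows "continuous_on {0..t} (\<lambda>s. LINT x|M. G s x)"
  unfolding continuous_on_sequentially comp_def
proof (intro allI ballI impI, elim conjE)
  fix s r assume s: "\<forall>n. s n \<in> {0..t}" and r: "r \<in> {0..t}" and lim: "s \<longlonglongrightarrow> r"
  show "(\<lambda>n. LINT x|M. G (s n) x) \<longlonglongrightarrow> (LINT x|M. G r x)"
  proof (rule integral_dominated_convergence)
    show "integrable M (\<lambda>x. K * min 1 ((norm x)\<^sup>2))"
      by (intro integrable_mult_right levy_measure_integrable_min levy)
    have "continuous_on {0..t} (\<lambda>s. G s x)" for x by (rule continuous_on_subset[OF cont]) auto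
    then have "(\<lambda>n. G (s n) x) \<longlonglongrightarrow> G r x" for x
      using s r lim unfolding continuous_on_sequentially comp_def by blast
    then show "AE x in M. (\<lambda>n. G (s n) x) \<longlonglongrightarrow> G r x" by simp
    show "AE x in M. norm (G (s n) x) \<le> K * min 1 ((norm x)\<^sup>2)" for n
      using bound s by (intro AE_I2) blast
  qed (use meas s r in \<open>auto simp: measurable_cong_sets[OF sets_M refl]\<close>)
qed

section \<open>The Levy symbol along the semigroup and its polarised form\<close>

definition symbol_integrand :: "'a \<Rightarrow> real \<Rightarrow> 'a \<Rightarrow> complex" where
  "symbol_integrand \<xi> s x = iexp (T s x \<bullet> \<xi>) - 1 - \<i> * of_real (T s x \<bullet> \<xi>) * indicator (ball 0 1) x"

text \<open>The symbol at the adjoint of \<open>T s\<close> applied to \<open>\<xi>\<close>, with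
  the operator moved to the other side of the inner product; continuity in \<open>s\<close> can then
  be read off from the orbits of \<open>T\<close>.\<close>

definition symbol :: "'a \<Rightarrow> real \<Rightarrow> complex" where
  "symbol \<xi> s = - \<i> * of_real (T s b \<bullet> \<xi>) - (LINT x|M. symbol_integrand \<xi> s x)"

text \<open>The product of the relative increments of two exponentials under the jump
  \<open>T s x\<close>; its integral \<open>cross\<close> is the carre du champ of the jump
  part.\<close>

definition cross_integrand :: "'a \<Rightarrow> 'a \<Rightarrow> real \<Rightarrow> 'a \<Rightarrow> complex" where
  "cross_integrand \<xi> \<eta> s x = (iexp (T s x \<bullet> \<xi>) - 1) * (iexp (T s x \<bullet> \<eta>) - 1)"

definition cross :: "'a \<Rightarrow> 'a \<Rightarrow> real \<Rightarrow> complex" where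
  "cross \<xi> \<eta> s = (LINT x|M. cross_integrand \<xi> \<eta> s x)"

lemma levy_symbol_adjoint:
  assumes "s \<ge> 0"
  shows "levy_symbol b M (adjoint (T s) \<xi>) = symbol \<xi> s"
proof -
  have "adjoint (T s) \<xi> \<bullet> b = T s b \<bullet> \<xi>"
    using inner_adjoint[OF T_linear[OF assms], of b \<xi>] by (simp add: inner_commute)
  then show ?thesis
    by (simp add: levy_symbol_def symbol_def symbol_integrand_def inner_adjoint[OF T_linear[OF assms]])
qed

lemma T_inner_bound:
  "\<exists>K\<ge>0. \<forall>s\<in>{0..t}. \<forall>x. \<bar>T s x \<bullet> \<xi>\<bar> \<le> K * norm x"
proof -
  obtain K where K: "K \<ge> 1" "\<And>s x. s \<in> {0..t} \<Longrightarrow> norm (T s x) \<le> K * norm x"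
    using T_locally_bounded[of t] by blast
  have "\<bar>T s x \<bullet> \<xi>\<bar> \<le> (K * norm \<xi>) * norm x" if "s \<in> {0..t}" for s x
    using Cauchy_Schwarz_ineq2[of "T s x" \<xi>] mult_right_mono[OF K(2)[OF that, of x], of "norm \<xi>"]
    by (simp add: mult_ac)
  then show ?thesis using K(1) by (intro exI[of _ "K * norm \<xi>"]) auto
qed

text \<open>Inside the unit ball this is a second-order Taylor remainder; outside, the compensator
  vanishes and the rest is at most 2. The constant adds the two cases.\<close>

lemma symbol_integrand_bound:
  "\<exists>K. \<forall>s\<in>{0..t}. \<forall>x. norm (symbol_integrand \<xi> s x) \<le> K * min 1 ((norm x)\<^sup>2)"
proof -
  obtain K where K: "K \<ge> 0" "\<And>s x. s \<in> {0..t} \<Longrightarrow> \<bar>T s x \<bullet> \<xi>\<bar> \<le> K * norm x"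
    using T_inner_bound[of t \<xi>] by blast
  have "norm (symbol_integrand \<xi> s x) \<le> (2 + K\<^sup>2) * min 1 ((norm x)\<^sup>2)" if s: "s \<in> {0..t}" for s x
  proof (cases "norm x < 1")
    case True
    let ?a = "T s x \<bullet> \<xi>"
    have "symbol_integrand \<xi> s x = iexp ?a - (\<Sum>k\<le>1. (\<i> * ?a) ^ k / fact k)"
      using True by (simp add: symbol_integrand_def)
    also have "norm \<dots> \<le> \<bar>?a\<bar>\<^sup>2 / 2"
      using iexp_approx1[of ?a 1] by (simp add: eval_nat_numeral)
    also have "\<dots> \<le> (K * norm x)\<^sup>2 / 2"
      using K(2)[OF s, of x] by (intro divide_right_mono power_mono) auto
    also have "\<dots> \<le> (2 + K\<^sup>2) * (norm x)\<^sup>2"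
      by (simp add: power_mult_distrib distrib_right)
    also have "(norm x)\<^sup>2 = min 1 ((norm x)\<^sup>2)"
      using power_le_one[of "norm x" 2] True by (simp add: min_def)
    finally show ?thesis .
  next
    case False
    then have "norm (symbol_integrand \<xi> s x) \<le> 2"
      using norm_iexp_diff_le_2 by (simp add: symbol_integrand_def)
    also have "\<dots> \<le> 2 + K\<^sup>2" by simp
    also have "\<dots> = (2 + K\<^sup>2) * min 1 ((norm x)\<^sup>2)"
      using False by (simp add: min_def)
    finally show ?thesis .
  qed
  then show ?thesis by blast
qed

text \<open>Two first-order factors give the squared norm near 0 without any compensator; far away
  each factor is at most 2.\<close>

lemma cross_integrand_bound:
  "\<exists>K. \<forall>s\<in>{0..t}. \<forall>x. norm (cross_integrand \<xi> \<eta> s x) \<le> K * min 1 ((norm x)\<^sup>2)"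
proof -
  obtain K where K: "K \<ge> 0" "\<And>s x. s \<in> {0..t} \<Longrightarrow> \<bar>T s x \<bullet> \<xi>\<bar> \<le> K * norm x"
    using T_inner_bound[of t \<xi>] by blast
  obtain L where L: "L \<ge> 0" "\<And>s x. s \<in> {0..t} \<Longrightarrow> \<bar>T s x \<bullet> \<eta>\<bar> \<le> L * norm x"
    using T_inner_bound[of t \<eta>] by blast
  have "norm (cross_integrand \<xi> \<eta> s x) \<le> (4 + K * L) * min 1 ((norm x)\<^sup>2)" if s: "s \<in> {0..t}" for s x
  proof (cases "(norm x)\<^sup>2 \<le> 1")
    case True
    have "norm (cross_integrand \<xi> \<eta> s x) \<le> (K * norm x) * (L * norm x)"
      unfolding cross_integrand_def norm_mult
      by (intro mult_mono order_trans[OF norm_iexp_diff_le] K(2)[OF s] L(2)[OF s]) (use K(1) in auto)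
    also have "\<dots> \<le> (4 + K * L) * (norm x)\<^sup>2"
      by (simp add: power2_eq_square distrib_right)
    finally show ?thesis using True by (simp add: min_def)
  next
    case False
    have "norm (cross_integrand \<xi> \<eta> s x) \<le> 2 * 2"
      unfolding cross_integrand_def norm_mult by (intro mult_mono norm_iexp_diff_le_2) auto
    also have "\<dots> \<le> 4 + K * L" using K L by simp
    finally show ?thesis using False by (simp add: min_def)
  qed
  then show ?thesis by blast
qed

lemma symbol_integrand_measurable: "s \<ge> 0 \<Longrightarrow> symbol_integrand \<xi> s \<in> borel_measurable borel"
  unfolding symbol_integrand_def[abs_def] using T_measurable[of s]
  by (intro borel_measurable_diff borel_measurable_times borel_measurable_indicator borel_open open_ball)
    (measurable, auto)

lemma cross_integrand_measurable: "s \<ge> 0 \<Longrightarrow> cross_integrand \<xi> \<eta> s \<in> borel_measurable borel"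
  unfolding cross_integrand_def[abs_def] using T_measurable[of s] by measurable

lemma symbol_integrand_integrable: "s \<ge> 0 \<Longrightarrow> integrable M (symbol_integrand \<xi> s)"
proof -
  assume s: "s \<ge> 0"
  obtain K where K: "\<And>x. norm (symbol_integrand \<xi> s x) \<le> K * min 1 ((norm x)\<^sup>2)"
    using symbol_integrand_bound[of s \<xi>] s by force
  show ?thesis by (rule integrable_M_bound[OF symbol_integrand_measurable[OF s] K])
qed

lemma cross_integrand_integrable: "s \<ge> 0 \<Longrightarrow> integrable M (cross_integrand \<xi> \<eta> s)"
proof -
  assume s: "s \<ge> 0"
  obtain K where K: "\<And>x. norm (cross_integrand \<xi> \<eta> s x) \<le> K * min 1 ((norm x)\<^sup>2)"
    using cross_integrand_bound[of s \<xi> \<eta>] s by force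
  show ?thesis by (rule integrable_M_bound[OF cross_integrand_measurable[OF s] K])
qed

lemma symbol_continuous: "continuous_on {0..t} (symbol \<xi>)"
proof -
  obtain K where "\<And>s x. s \<in> {0..t} \<Longrightarrow> norm (symbol_integrand \<xi> s x) \<le> K * min 1 ((norm x)\<^sup>2)"
    using symbol_integrand_bound[of t \<xi>] by blast
  moreover have "continuous_on {0..} (\<lambda>s. symbol_integrand \<xi> s x)" for x
    unfolding symbol_integrand_def by (intro continuous_intros T_continuous)
  ultimately have "continuous_on {0..t} (\<lambda>s. LINT x|M. symbol_integrand \<xi> s x)"
    by (intro continuous_on_integral_M symbol_integrand_measurable)
  moreover have "continuous_on {0..t} (\<lambda>s. T s b)"
    by (rule continuous_on_subset[OF T_continuous]) auto
  ultimately show ?thesis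
    unfolding symbol_def[abs_def] by (intro continuous_intros)
qed

lemma cross_continuous: "continuous_on {0..t} (cross \<xi> \<eta>)"
proof -
  obtain K where "\<And>s x. s \<in> {0..t} \<Longrightarrow> norm (cross_integrand \<xi> \<eta> s x) \<le> K * min 1 ((norm x)\<^sup>2)"
    using cross_integrand_bound[of t \<xi> \<eta>] by blast
  moreover have "continuous_on {0..} (\<lambda>s. cross_integrand \<xi> \<eta> s x)" for x
    unfolding cross_integrand_def by (intro continuous_intros T_continuous)
  ultimately show ?thesis
    unfolding cross_def[abs_def] by (intro continuous_on_integral_M cross_integrand_measurable)
qed

text \<open>Drift and compensators are linear in the frequency and cancel, leaving exactly the
  product of the two increments.\<close>

lemma symbol_cross:
  assumes "s \<ge> 0"
  shows "symbol \<xi> s + symbol \<eta> s = symbol (\<xi> + \<eta>) s + cross \<xi> \<eta> s"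
proof -
  have "cross_integrand \<xi> \<eta> s =
      (\<lambda>x. symbol_integrand (\<xi> + \<eta>) s x - symbol_integrand \<xi> s x - symbol_integrand \<eta> s x)"
    by (simp add: fun_eq_iff cross_integrand_def symbol_integrand_def inner_add_right exp_add algebra_simps)
  then have "cross \<xi> \<eta> s = (LINT x|M. symbol_integrand (\<xi> + \<eta>) s x)
      - (LINT x|M. symbol_integrand \<xi> s x) - (LINT x|M. symbol_integrand \<eta> s x)"
    unfolding cross_def using symbol_integrand_integrable[OF assms]
    by (simp add: Bochner_Integration.integral_diff)
  then show ?thesis by (simp add: symbol_def inner_add_right algebra_simps)
qed

section \<open>Characteristic functions, invariance and the limit for large times\<close>

definition muhat :: "real \<Rightarrow> 'a \<Rightarrow> complex" where
  "muhat t \<xi> = (LINT y|\<mu> t. iexp (y \<bullet> \<xi>))"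

text \<open>The characteristic function of \<sigma> at the adjoint of \<open>T t\<close> applied to
  \<open>\<xi>\<close>; at \<open>t = 0\<close> it is that of \<sigma> itself.\<close>

definition sigmahat :: "real \<Rightarrow> 'a \<Rightarrow> complex" where
  "sigmahat t \<xi> = (LINT x|\<sigma>. iexp (T t x \<bullet> \<xi>))"

lemma muhat_eq:
  assumes "t \<ge> 0"
  shows "muhat t \<xi> = exp (- integral {0..t} (symbol \<xi>))"
proof -
  have "(LINT s:{0..t}|lborel. levy_symbol b M (adjoint (T s) \<xi>)) = (LINT s:{0..t}|lborel. symbol \<xi> s)"
    by (intro set_lebesgue_integral_cong) (auto simp: levy_symbol_adjoint)
  also have "\<dots> = integral {0..t} (symbol \<xi>)"
    by (intro set_borel_integral_eq_integral borel_integrable_atLeastAtMost' symbol_continuous)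
  finally show ?thesis
    using laws assms by (simp add: mehler_laws_def muhat_def)
qed

lemma muhat_mult:
  assumes "t \<ge> 0"
  shows "muhat t \<xi> * muhat t \<eta> = muhat t (\<xi> + \<eta>) * exp (- integral {0..t} (cross \<xi> \<eta>))"
proof -
  have int: "symbol \<zeta> integrable_on {0..t}" "cross \<xi> \<eta> integrable_on {0..t}" for \<zeta>
    by (intro integrable_continuous_interval symbol_continuous cross_continuous)+
  have "integral {0..t} (symbol \<xi>) + integral {0..t} (symbol \<eta>)
      = integral {0..t} (\<lambda>s. symbol \<xi> s + symbol \<eta> s)"
    by (intro integral_add[symmetric] int)
  also have "\<dots> = integral {0..t} (\<lambda>s. symbol (\<xi> + \<eta>) s + cross \<xi> \<eta> s)"
    by (intro integral_cong) (simp add: symbol_cross)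
  also have "\<dots> = integral {0..t} (symbol (\<xi> + \<eta>)) + integral {0..t} (cross \<xi> \<eta>)"
    by (intro integral_add int)
  finally show ?thesis
    unfolding muhat_eq[OF assms] exp_add[symmetric] minus_add_distrib[symmetric] by (simp only:)
qed

lemma iexp_\<mu>_integrable: "t \<ge> 0 \<Longrightarrow> integrable (\<mu> t) (\<lambda>y. iexp (y \<bullet> \<xi>))"
  using integrable_iexp_inner[of "\<mu> t" "\<lambda>y. y" \<xi>] prob_\<mu>[of t] sets_\<mu>[of t]
  by (simp add: prob_space.finite_measure)

lemma iexp_\<sigma>_integrable: "t \<ge> 0 \<Longrightarrow> integrable \<sigma> (\<lambda>x. iexp (T t x \<bullet> \<xi>))"
  using integrable_iexp_inner[of \<sigma> "T t" \<xi>] T_measurable[of t] \<sigma>.finite_measure_axioms by simp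

lemma T_0: "T 0 x = x"
  using semigroup by (simp add: C0_semigroup_def)

lemma muhat_0: "muhat 0 \<xi> = 1"
  by (simp add: muhat_eq)

lemma invariant_eq:
  assumes "t \<ge> 0" "f \<in> borel_measurable borel" "bounded (range f)"
  shows "(LINT x|\<sigma>. mehler_op T \<mu> t f x) = (LINT x|\<sigma>. f x)"
  using invariant assms by (simp add: invariant_measure_def)

text \<open>In terms of laws: \<sigma> is the convolution of its image under \<open>T t\<close> with
  \<open>\<mu> t\<close>.\<close>

lemma sigmahat_invariant:
  assumes t: "t \<ge> 0"
  shows "sigmahat 0 \<xi> = muhat t \<xi> * sigmahat t \<xi>"
proof -
  define q where "q x = (LINT y|\<mu> t. iexp ((T t x + y) \<bullet> \<xi>))" for x
  have q: "q x = iexp (T t x \<bullet> \<xi>) * muhat t \<xi>" for x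
    by (simp add: q_def muhat_def inner_add_left distrib_left exp_add)
  have int_q: "integrable \<sigma> q" unfolding q by (intro integrable_mult_left iexp_\<sigma>_integrable t)
  have int: "integrable (\<mu> t) (\<lambda>y. iexp ((T t x + y) \<bullet> \<xi>))" for x
    using integrable_iexp_inner[of "\<mu> t" "\<lambda>y. T t x + y" \<xi>] prob_\<mu>[OF t] sets_\<mu>[OF t]
    by (simp add: prob_space.finite_measure)
  \<comment> \<open>Invariance is stated for real bounded functions, so the exponential is tested
    through its cosine and sine parts.\<close>
  have "Re (q x) = mehler_op T \<mu> t (\<lambda>z. cos (z \<bullet> \<xi>)) x"
    "Im (q x) = mehler_op T \<mu> t (\<lambda>z. sin (z \<bullet> \<xi>)) x" for x
    unfolding q_def mehler_op_def using int[of x]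
    by (simp_all add: integral_Re[symmetric] integral_Im[symmetric] Re_exp Im_exp)
  then have "Re (LINT x|\<sigma>. q x) = (LINT x|\<sigma>. mehler_op T \<mu> t (\<lambda>z. cos (z \<bullet> \<xi>)) x)"
    "Im (LINT x|\<sigma>. q x) = (LINT x|\<sigma>. mehler_op T \<mu> t (\<lambda>z. sin (z \<bullet> \<xi>)) x)"
    using int_q by (simp_all add: integral_Re[symmetric] integral_Im[symmetric])
  moreover have "bounded (range (\<lambda>z. cos (z \<bullet> \<xi>)))" "bounded (range (\<lambda>z. sin (z \<bullet> \<xi>)))"
    by (auto simp: bounded_iff intro!: exI[of _ 1])
  then have "(LINT x|\<sigma>. mehler_op T \<mu> t (\<lambda>z. cos (z \<bullet> \<xi>)) x) = (LINT x|\<sigma>. cos (x \<bullet> \<xi>))"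
    "(LINT x|\<sigma>. mehler_op T \<mu> t (\<lambda>z. sin (z \<bullet> \<xi>)) x) = (LINT x|\<sigma>. sin (x \<bullet> \<xi>))"
    using t by (auto intro!: invariant_eq)
  moreover have "Re (sigmahat 0 \<xi>) = (LINT x|\<sigma>. cos (x \<bullet> \<xi>))"
    "Im (sigmahat 0 \<xi>) = (LINT x|\<sigma>. sin (x \<bullet> \<xi>))"
    unfolding sigmahat_def T_0 using iexp_\<sigma>_integrable[of 0 \<xi>]
    by (simp_all add: T_0 integral_Re[symmetric] integral_Im[symmetric] Re_exp Im_exp)
  ultimately have "sigmahat 0 \<xi> = (LINT x|\<sigma>. q x)"
    by (simp add: complex_eq_iff)
  also have "\<dots> = muhat t \<xi> * sigmahat t \<xi>"
    by (simp add: q sigmahat_def)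
  finally show ?thesis .
qed

text \<open>The \<sigma>-integral of the product, without conjugation, of P_t applied to the
  exponentials with frequencies \<open>\<xi>\<close> and \<open>\<eta>\<close>.\<close>

definition mixed :: "real \<Rightarrow> 'a \<Rightarrow> 'a \<Rightarrow> complex" where
  "mixed t \<xi> \<eta> = muhat t \<xi> * muhat t \<eta> * sigmahat t (\<xi> + \<eta>)"

text \<open>Invariance absorbs both factors at frequency \<open>\<xi> + \<eta>\<close> into a
  constant, so all time dependence sits in one explicit exponential and \<open>sigmahat\<close>
  never has to be differentiated.\<close>

lemma mixed_eq:
  "t \<ge> 0 \<Longrightarrow> mixed t \<xi> \<eta> = sigmahat 0 (\<xi> + \<eta>) * exp (- integral {0..t} (cross \<xi> \<eta>))"
  unfolding mixed_def muhat_mult sigmahat_invariant[of t "\<xi> + \<eta>"] by simp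

lemma mixed_has_derivative:
  assumes t: "t \<in> {0..t0}"
  shows "((\<lambda>t. mixed t \<xi> \<eta>) has_vector_derivative - (cross \<xi> \<eta> t * mixed t \<xi> \<eta>)) (at t within {0..t0})"
proof -
  let ?I = "\<lambda>t. - integral {0..t} (cross \<xi> \<eta>)"
  have "(?I has_vector_derivative - cross \<xi> \<eta> t) (at t within {0..t0})"
    by (intro has_vector_derivative_minus integral_has_vector_derivative cross_continuous t)
  then have "((exp \<circ> ?I) has_vector_derivative (- cross \<xi> \<eta> t) * exp (?I t)) (at t within {0..t0})"
    by (rule field_vector_diff_chain_within[OF _ has_field_derivative_at_within[OF DERIV_exp]])
  then have "((\<lambda>t. sigmahat 0 (\<xi> + \<eta>) * (exp \<circ> ?I) t) has_vector_derivative
      sigmahat 0 (\<xi> + \<eta>) * ((- cross \<xi> \<eta> t) * exp (?I t))) (at t within {0..t0})"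
    by (rule has_vector_derivative_mult_right)
  moreover have "sigmahat 0 (\<xi> + \<eta>) * ((- cross \<xi> \<eta> t) * exp (?I t)) = - (cross \<xi> \<eta> t * mixed t \<xi> \<eta>)"
    using t by (simp add: mixed_eq)
  ultimately have "((\<lambda>t. sigmahat 0 (\<xi> + \<eta>) * (exp \<circ> ?I) t) has_vector_derivative
      - (cross \<xi> \<eta> t * mixed t \<xi> \<eta>)) (at t within {0..t0})" by (simp only:)
  then show ?thesis
    by (rule has_vector_derivative_transform[rotated 2]) (use t in \<open>simp_all add: mixed_eq\<close>)
qed

text \<open>Decay of the orbits sends \<open>sigmahat t\<close> to 1, and the invariance identity
  then forces \<open>muhat t\<close> to converge to the characteristic function of \<sigma>.\<close>

lemma mixed_tendsto:
  assumes "\<And>x. ((\<lambda>t. T t x) \<longlongrightarrow> 0) at_top"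
  shows "((\<lambda>t. mixed t \<xi> \<eta>) \<longlongrightarrow> sigmahat 0 \<xi> * sigmahat 0 \<eta>) at_top"
proof -
  have S: "((\<lambda>t. sigmahat t \<zeta>) \<longlongrightarrow> 1) at_top" for \<zeta>
  proof -
    \<comment> \<open>The convergence theorem asks for measurability at every real \<open>t\<close>,
      while \<open>T t\<close> is controlled only for \<open>t \<ge> 0\<close>.\<close>
    have "((\<lambda>t. LINT x|\<sigma>. iexp (T (max t 0) x \<bullet> \<zeta>)) \<longlongrightarrow> (LINT x|\<sigma>. 1)) at_top"
    proof (rule integral_dominated_convergence_at_top[where w = "\<lambda>_. 1"])
      show "(\<lambda>x. iexp (T (max t 0) x \<bullet> \<zeta>)) \<in> borel_measurable \<sigma>" for t
        by (rule borel_measurable_integrable[OF iexp_\<sigma>_integrable]) simp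
      have "((\<lambda>t. iexp (T t x \<bullet> \<zeta>)) \<longlongrightarrow> iexp (0 \<bullet> \<zeta>)) at_top" for x
        by (intro tendsto_intros assms)
      moreover have "\<forall>\<^sub>F t in at_top. max t 0 = (t::real)"
        using eventually_ge_at_top[of 0] by eventually_elim simp
      then have "\<forall>\<^sub>F t in at_top. iexp (T t x \<bullet> \<zeta>) = iexp (T (max t 0) x \<bullet> \<zeta>)" for x
        by eventually_elim (simp only:)
      ultimately have "((\<lambda>t. iexp (T (max t 0) x \<bullet> \<zeta>)) \<longlongrightarrow> iexp (0 \<bullet> \<zeta>)) at_top" for x
        by (rule Lim_transform_eventually)
      then show "AE x in \<sigma>. ((\<lambda>t. iexp (T (max t 0) x \<bullet> \<zeta>)) \<longlongrightarrow> 1) at_top" by simp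
    qed auto
    moreover have "\<forall>\<^sub>F t in at_top. (LINT x|\<sigma>. iexp (T (max t 0) x \<bullet> \<zeta>)) = sigmahat t \<zeta>"
      using eventually_ge_at_top[of 0] by eventually_elim (simp add: sigmahat_def)
    ultimately have "((\<lambda>t. sigmahat t \<zeta>) \<longlongrightarrow> (LINT x|\<sigma>. 1)) at_top"
      by (rule Lim_transform_eventually)
    then show ?thesis by (simp add: \<sigma>.prob_space)
  qed
  have mu: "((\<lambda>t. muhat t \<zeta>) \<longlongrightarrow> sigmahat 0 \<zeta>) at_top" for \<zeta>
  proof -
    have "((\<lambda>t. sigmahat 0 \<zeta> / sigmahat t \<zeta>) \<longlongrightarrow> sigmahat 0 \<zeta> / 1) at_top"
      by (intro tendsto_intros S) simp
    \<comment> \<open>Since the limit is 1, the denominator is eventually nonzero and the invariance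
      identity may be solved for \<open>muhat\<close>.\<close>
    moreover have "\<forall>\<^sub>F t in at_top. sigmahat t \<zeta> \<noteq> 0"
      by (rule tendsto_imp_eventually_ne[OF S]) simp
    then have "\<forall>\<^sub>F t in at_top. sigmahat 0 \<zeta> / sigmahat t \<zeta> = muhat t \<zeta>"
      using eventually_ge_at_top[of 0]
      by eventually_elim (simp add: sigmahat_invariant[of _ \<zeta>])
    ultimately have "((\<lambda>t. muhat t \<zeta>) \<longlongrightarrow> sigmahat 0 \<zeta> / 1) at_top"
      by (rule Lim_transform_eventually)
    then show ?thesis by simp
  qed
  have "((\<lambda>t. mixed t \<xi> \<eta>) \<longlongrightarrow> sigmahat 0 \<xi> * sigmahat 0 \<eta> * 1) at_top"
    unfolding mixed_def by (intro tendsto_intros mu S)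
  then show ?thesis by simp
qed

section \<open>Evolution, second moment and energy of exponential sums\<close>

lemma mehler_op_exp_sum:
  assumes f: "\<And>x. complex_of_real (f x) = (\<Sum>i<n::nat. c i * iexp (x \<bullet> \<xi> i))" and t: "t \<ge> 0"
  shows "complex_of_real (mehler_op T \<mu> t f x) = (\<Sum>i<n. c i * muhat t (\<xi> i) * iexp (T t x \<bullet> \<xi> i))"
proof -
  have "complex_of_real (mehler_op T \<mu> t f x) = (LINT y|\<mu> t. complex_of_real (f (T t x + y)))"
    by (simp add: mehler_op_def)
  also have "\<dots> = (LINT y|\<mu> t. (\<Sum>i<n. (c i * iexp (T t x \<bullet> \<xi> i)) * iexp (y \<bullet> \<xi> i)))"
    by (simp add: f inner_add_left distrib_left exp_add mult.assoc)
  also have "\<dots> = (\<Sum>i<n. (LINT y|\<mu> t. (c i * iexp (T t x \<bullet> \<xi> i)) * iexp (y \<bullet> \<xi> i)))"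
    by (intro Bochner_Integration.integral_sum integrable_mult_right iexp_\<mu>_integrable t)
  finally show ?thesis by (simp add: muhat_def mult_ac)
qed

lemma mehler_op_square_exp_sum:
  assumes f: "\<And>x. complex_of_real (f x) = (\<Sum>i<n::nat. c i * iexp (x \<bullet> \<xi> i))" and t: "t \<ge> 0"
  shows "complex_of_real (LINT x|\<sigma>. (mehler_op T \<mu> t f x)\<^sup>2) =
    (\<Sum>i<n. \<Sum>j<n. c i * c j * mixed t (\<xi> i) (\<xi> j))"
proof -
  define a where "a i = c i * muhat t (\<xi> i)" for i
  have "complex_of_real (LINT x|\<sigma>. (mehler_op T \<mu> t f x)\<^sup>2) =
      (LINT x|\<sigma>. complex_of_real ((mehler_op T \<mu> t f x)\<^sup>2))"
    by (rule integral_complex_of_real[symmetric])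
  also have "\<dots> = (LINT x|\<sigma>. (\<Sum>i<n. \<Sum>j<n. (a i * a j) * iexp (T t x \<bullet> (\<xi> i + \<xi> j))))"
    by (simp add: mehler_op_exp_sum[OF f t] power2_eq_square sum_product a_def
        inner_add_right distrib_left exp_add mult_ac del: integral_complex_of_real)
  also have "\<dots> = (\<Sum>i<n. \<Sum>j<n. (LINT x|\<sigma>. (a i * a j) * iexp (T t x \<bullet> (\<xi> i + \<xi> j))))"
    by (subst Bochner_Integration.integral_sum;
        intro Bochner_Integration.integrable_sum integrable_mult_right iexp_\<sigma>_integrable t sum.cong refl
          Bochner_Integration.integral_sum)
  finally show ?thesis by (simp add: sigmahat_def mixed_def a_def mult_ac)
qed

text \<open>An increment of an evolved exponential factors into its value at \<open>x\<close> and a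
  function of the jump, so the M-integral yields \<open>cross\<close> and the \<sigma>-integral
  \<open>mixed\<close>. Term by term this is minus the derivative in
  \<open>mixed_has_derivative\<close>.\<close>

lemma mehler_op_energy_exp_sum:
  assumes f: "\<And>x. complex_of_real (f x) = (\<Sum>i<n::nat. c i * iexp (x \<bullet> \<xi> i))" and t: "t \<ge> 0"
  shows "complex_of_real (energy M \<sigma> (mehler_op T \<mu> t f)) =
    (\<Sum>i<n. \<Sum>j<n. c i * c j * (cross (\<xi> i) (\<xi> j) t * mixed t (\<xi> i) (\<xi> j)))"
proof -
  let ?P = "mehler_op T \<mu> t f"
  define a where "a i = c i * muhat t (\<xi> i)" for i
  have sq: "complex_of_real (\<bar>?P (x + y) - ?P x\<bar>\<^sup>2) =
      (\<Sum>i<n. \<Sum>j<n. (a i * a j * iexp (T t x \<bullet> (\<xi> i + \<xi> j))) * cross_integrand (\<xi> i) (\<xi> j) t y)" for x y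
  proof -
    have "complex_of_real (?P (x + y) - ?P x) = (\<Sum>i<n. a i * iexp (T t x \<bullet> \<xi> i) * (iexp (T t y \<bullet> \<xi> i) - 1))"
      unfolding of_real_diff mehler_op_exp_sum[OF f t] sum_subtractf[symmetric]
      by (intro sum.cong refl) (simp add: a_def T_add[OF t] inner_add_left distrib_left exp_add algebra_simps)
    then show ?thesis
      by (simp add: power2_eq_square sum_product cross_integrand_def inner_add_right distrib_left exp_add mult_ac)
  qed
  have inner: "complex_of_real (LINT y|M. \<bar>?P (x + y) - ?P x\<bar>\<^sup>2) =
      (\<Sum>i<n. \<Sum>j<n. (a i * a j * cross (\<xi> i) (\<xi> j) t) * iexp (T t x \<bullet> (\<xi> i + \<xi> j)))" for x
  proof -
    have "complex_of_real (LINT y|M. \<bar>?P (x + y) - ?P x\<bar>\<^sup>2) = (LINT y|M. complex_of_real (\<bar>?P (x + y) - ?P x\<bar>\<^sup>2))"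
      by (rule integral_complex_of_real[symmetric])
    also have "\<dots> = (\<Sum>i<n. \<Sum>j<n. (LINT y|M. (a i * a j * iexp (T t x \<bullet> (\<xi> i + \<xi> j))) * cross_integrand (\<xi> i) (\<xi> j) t y))"
      unfolding sq
      by (subst Bochner_Integration.integral_sum;
        intro Bochner_Integration.integrable_sum integrable_mult_right cross_integrand_integrable t sum.cong refl
          Bochner_Integration.integral_sum)
    finally show ?thesis by (simp add: cross_def mult_ac)
  qed
  have "complex_of_real (energy M \<sigma> ?P) = (LINT x|\<sigma>. complex_of_real (LINT y|M. \<bar>?P (x + y) - ?P x\<bar>\<^sup>2))"
    unfolding energy_def by (rule integral_complex_of_real[symmetric])
  also have "\<dots> = (\<Sum>i<n. \<Sum>j<n. (LINT x|\<sigma>. (a i * a j * cross (\<xi> i) (\<xi> j) t) * iexp (T t x \<bullet> (\<xi> i + \<xi> j))))"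
    unfolding inner
    by (subst Bochner_Integration.integral_sum;
        intro Bochner_Integration.integrable_sum integrable_mult_right iexp_\<sigma>_integrable t sum.cong refl
          Bochner_Integration.integral_sum)
  finally show ?thesis by (simp add: sigmahat_def mixed_def a_def mult_ac)
qed

section \<open>Functions whose squared increments M integrates uniformly in the base point\<close>

definition jump_bounded :: "real \<Rightarrow> ('a \<Rightarrow> real) \<Rightarrow> bool" where
  "jump_bounded K g \<longleftrightarrow> K \<ge> 0 \<and> g \<in> borel_measurable borel \<and>
     (\<forall>x y. (g (x + y) - g x)\<^sup>2 \<le> K * min 1 ((norm y)\<^sup>2))"

text \<open>Small jumps use the Lipschitz bound, large ones the sup bound, whose increments reach
  2K; hence the factor 4.\<close>

lemma jump_bounded_lipschitz:
  assumes "g \<in> borel_measurable borel" "\<And>x. \<bar>g x\<bar> \<le> K" "\<And>x y. \<bar>g (x + y) - g x\<bar> \<le> K * norm y"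
  shows "jump_bounded (4 * K\<^sup>2) g"
proof -
  have "(g (x + y) - g x)\<^sup>2 \<le> 4 * K\<^sup>2 * min 1 ((norm y)\<^sup>2)" for x y
  proof (cases "(norm y)\<^sup>2 \<le> 1")
    case True
    have "(g (x + y) - g x)\<^sup>2 \<le> (K * norm y)\<^sup>2"
      using assms(3)[of x y] by (metis power2_abs abs_ge_zero power_mono)
    also have "\<dots> \<le> 4 * K\<^sup>2 * (norm y)\<^sup>2" by (simp add: power_mult_distrib mult_right_mono)
    finally show ?thesis using True by (simp add: min_def)
  next
    case False
    have "\<bar>g (x + y) - g x\<bar> \<le> 2 * K" using assms(2)[of x] assms(2)[of "x + y"] by linarith
    then have "(g (x + y) - g x)\<^sup>2 \<le> (2 * K)\<^sup>2" by (metis power2_abs abs_ge_zero power_mono)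
    then show ?thesis using False by (simp add: min_def power_mult_distrib)
  qed
  then show ?thesis using assms(1) by (simp add: jump_bounded_def)
qed

lemma jump_measurable_pair:
  assumes "g \<in> borel_measurable borel"
  shows "(\<lambda>(x, y). (g (x + y) - g x)\<^sup>2 :: real) \<in> borel_measurable (\<sigma> \<Otimes>\<^sub>M M)"
  using assms by measurable

lemma jump_integrable:
  assumes "jump_bounded K g"
  shows "integrable M (\<lambda>y. (g (x + y) - g x)\<^sup>2)"
proof (rule integrable_M_bound)
  have [measurable]: "g \<in> borel_measurable borel" using assms by (simp add: jump_bounded_def)
  show "(\<lambda>y. (g (x + y) - g x)\<^sup>2) \<in> borel_measurable borel" by measurable
  show "norm ((g (x + y) - g x)\<^sup>2) \<le> K * min 1 ((norm y)\<^sup>2)" for y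
    using assms unfolding jump_bounded_def by simp
qed

lemma jump_integral_le:
  assumes "jump_bounded K g"
  shows "(LINT y|M. (g (x + y) - g x)\<^sup>2) \<le> K * (LINT y|M. min 1 ((norm y)\<^sup>2))"
proof -
  have "(LINT y|M. (g (x + y) - g x)\<^sup>2) \<le> (LINT y|M. K * min 1 ((norm y)\<^sup>2))"
    using assms
    by (intro integral_mono jump_integrable[OF assms] integrable_mult_right levy_measure_integrable_min levy)
      (simp add: jump_bounded_def)
  then show ?thesis by simp
qed

lemma jump_integral_integrable:
  assumes "jump_bounded K g"
  shows "integrable \<sigma> (\<lambda>x. LINT y|M. (g (x + y) - g x)\<^sup>2)"
proof (rule \<sigma>.integrable_const_bound)
  show "AE x in \<sigma>. norm (LINT y|M. (g (x + y) - g x)\<^sup>2) \<le> K * (LINT y|M. min 1 ((norm y)\<^sup>2))"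
    using jump_integral_le[OF assms] by (intro AE_I2) simp
  show "(\<lambda>x. LINT y|M. (g (x + y) - g x)\<^sup>2) \<in> borel_measurable \<sigma>"
    using assms
    by (intro M.borel_measurable_lebesgue_integral jump_measurable_pair) (simp add: jump_bounded_def)
qed

lemma energy_square: "energy M \<sigma> g = (LINT x|\<sigma>. LINT y|M. (g (x + y) - g x)\<^sup>2)"
  by (simp add: energy_def)

text \<open>A Bochner integral is 0 when its integrand is not integrable. The jump bound excludes
  this at both levels, so monotonicity and Tonelli can be used freely.\<close>

lemma ennreal_energy:
  assumes "jump_bounded K g"
  shows "ennreal (energy M \<sigma> g) = (\<integral>\<^sup>+x. \<integral>\<^sup>+y. ennreal ((g (x + y) - g x)\<^sup>2) \<partial>M \<partial>\<sigma>)"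
proof -
  have "(\<integral>\<^sup>+y. ennreal ((g (x + y) - g x)\<^sup>2) \<partial>M) = ennreal (LINT y|M. (g (x + y) - g x)\<^sup>2)" for x
    by (intro nn_integral_eq_integral jump_integrable[OF assms]) simp
  then show ?thesis
    unfolding energy_square
    by (simp add: nn_integral_eq_integral[OF jump_integral_integrable[OF assms]] integral_nonneg_AE)
qed

lemma mehler_op_measurable:
  assumes t: "t \<ge> 0" and "f \<in> borel_measurable borel"
  shows "mehler_op T \<mu> t f \<in> borel_measurable borel"
proof -
  interpret \<mu>: prob_space "\<mu> t" by (rule prob_\<mu>[OF t])
  note sets_\<mu>[OF t, measurable_cong] T_measurable[OF t, measurable] assms(2)[measurable]
  show ?thesis unfolding mehler_op_def[abs_def]
    by (intro \<mu>.borel_measurable_lebesgue_integral) measurable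
qed

text \<open>A jump by \<open>y\<close> before the evolution is a jump by \<open>T t y\<close> under
  the average that defines P_t; Jensen moves the square inside.\<close>

lemma mehler_op_jump_le:
  assumes t: "t \<ge> 0" and f: "f \<in> borel_measurable borel" "\<And>x. \<bar>f x\<bar> \<le> B"
  shows "(mehler_op T \<mu> t f (x + y) - mehler_op T \<mu> t f x)\<^sup>2
    \<le> mehler_op T \<mu> t (\<lambda>z. (f (z + T t y) - f z)\<^sup>2) x"
proof -
  interpret \<mu>: prob_space "\<mu> t" by (rule prob_\<mu>[OF t])
  note sets_\<mu>[OF t, measurable_cong] f(1)[measurable]
  have int: "integrable (\<mu> t) (\<lambda>z. f (v + z))" for v
    by (rule \<mu>.integrable_const_bound[of _ B]) (use f(2) in simp_all)
  have int2: "integrable (\<mu> t) (\<lambda>z. (f (T t x + z + T t y) - f (T t x + z))\<^sup>2)"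
  proof (rule \<mu>.integrable_const_bound[of _ "(2 * B)\<^sup>2"])
    have "\<bar>f (T t x + z + T t y) - f (T t x + z)\<bar> \<le> 2 * B" for z
      using f(2)[of "T t x + z + T t y"] f(2)[of "T t x + z"] by linarith
    then have "(f (T t x + z + T t y) - f (T t x + z))\<^sup>2 \<le> (2 * B)\<^sup>2" for z
      by (metis power2_abs abs_ge_zero power_mono)
    then show "AE z in \<mu> t. norm ((f (T t x + z + T t y) - f (T t x + z))\<^sup>2) \<le> (2 * B)\<^sup>2" by simp
  qed measurable
  have "mehler_op T \<mu> t f (x + y) - mehler_op T \<mu> t f x
      = (LINT z|\<mu> t. f (T t x + z + T t y) - f (T t x + z))"
    using int[of "T t x + T t y"] int[of "T t x"]
    by (simp add: mehler_op_def T_add[OF t] add_ac)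
  also have "\<dots>\<^sup>2 \<le> (LINT z|\<mu> t. (f (T t x + z + T t y) - f (T t x + z))\<^sup>2)"
    using int[of "T t x + T t y"] int[of "T t x"]
    by (intro \<mu>.square_expectation_le int2 Bochner_Integration.integrable_diff) (simp_all add: add_ac)
  finally show ?thesis by (simp add: mehler_op_def)
qed

lemma mehler_op_jump_bounded:
  assumes t: "t \<ge> 0" and f: "jump_bounded K f" "\<And>x. \<bar>f x\<bar> \<le> B"
  shows "\<exists>K'. jump_bounded K' (mehler_op T \<mu> t f)"
proof -
  interpret \<mu>: prob_space "\<mu> t" by (rule prob_\<mu>[OF t])
  note sets_\<mu>[OF t, measurable_cong]
  have meas[measurable]: "f \<in> borel_measurable borel" using f(1) by (simp add: jump_bounded_def)
  have fK: "(f (x + y) - f x)\<^sup>2 \<le> K * min 1 ((norm y)\<^sup>2)" for x y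
    using f(1) by (simp add: jump_bounded_def)
  have K: "K \<ge> 0" using f(1) by (simp add: jump_bounded_def)
  obtain L where L: "L \<ge> 1" "\<And>y. norm (T t y) \<le> L * norm y"
    using T_locally_bounded[of t] t by force
  have "(mehler_op T \<mu> t f (x + y) - mehler_op T \<mu> t f x)\<^sup>2 \<le> (K * L\<^sup>2) * min 1 ((norm y)\<^sup>2)" for x y
  proof -
    have "(mehler_op T \<mu> t f (x + y) - mehler_op T \<mu> t f x)\<^sup>2
        \<le> (LINT z|\<mu> t. (f (T t x + z + T t y) - f (T t x + z))\<^sup>2)"
      using mehler_op_jump_le[OF t meas f(2), of x y] by (simp add: mehler_op_def)
    also have "\<dots> \<le> (LINT z|\<mu> t. K * min 1 ((norm (T t y))\<^sup>2))"
    proof (rule integral_mono)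
      show "integrable (\<mu> t) (\<lambda>z. (f (T t x + z + T t y) - f (T t x + z))\<^sup>2)"
        by (rule \<mu>.integrable_const_bound[of _ "K * min 1 ((norm (T t y))\<^sup>2)"]) (use fK in simp_all)
    qed (use fK in simp_all)
    also have "\<dots> = K * min 1 ((norm (T t y))\<^sup>2)" by (simp add: \<mu>.prob_space)
    also have "\<dots> \<le> K * (L\<^sup>2 * min 1 ((norm y)\<^sup>2))"
    proof (intro mult_left_mono K)
      have "(norm (T t y))\<^sup>2 \<le> L\<^sup>2 * (norm y)\<^sup>2"
        using power_mono[OF L(2)[of y], of 2] by (simp add: power_mult_distrib)
      \<comment> \<open>This is what allows the constant to pass through the minimum with 1.\<close>
      moreover have "1 \<le> L\<^sup>2" using L(1) by (rule one_le_power)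
      ultimately show "min 1 ((norm (T t y))\<^sup>2) \<le> L\<^sup>2 * min 1 ((norm y)\<^sup>2)"
        by (auto simp: min_def)
    qed
    finally show ?thesis by (simp add: mult_ac)
  qed
  then show ?thesis using mehler_op_measurable[OF t meas] K
    by (intro exI[of _ "K * L\<^sup>2"]) (simp add: jump_bounded_def)
qed

text \<open>After Jensen and Tonelli the jump \<open>y\<close> is fixed, so invariance can remove
  P_t in the variable \<open>x\<close>. What remains depends on \<open>T t y\<close> alone and falls
  to the domination hypothesis \<open>dom\<close>.\<close>

lemma energy_mehler_op_le:
  assumes t: "t \<ge> 0" and f: "jump_bounded K f" "\<And>x. \<bar>f x\<bar> \<le> B"
    and dom: "\<And>w. w \<in> borel_measurable borel \<Longrightarrow> (\<integral>\<^sup>+y. w (T t y) \<partial>M) \<le> ennreal c * (\<integral>\<^sup>+y. w y \<partial>M)"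
    and c: "c \<ge> 0"
  shows "energy M \<sigma> (mehler_op T \<mu> t f) \<le> c * energy M \<sigma> f"
proof -
  interpret \<mu>: prob_space "\<mu> t" by (rule prob_\<mu>[OF t])
  note sets_\<mu>[OF t, measurable_cong] T_measurable[OF t, measurable]
  have meas[measurable]: "f \<in> borel_measurable borel" using f(1) by (simp add: jump_bounded_def)
  let ?P = "mehler_op T \<mu> t f"
  define g where "g y z = (f (z + y) - f z)\<^sup>2" for y z
  have g_meas: "(\<lambda>(y, z). g y z) \<in> borel_measurable (borel \<Otimes>\<^sub>M borel)" unfolding g_def by measurable
  then have g_meas1[measurable]: "g y \<in> borel_measurable borel" for y unfolding g_def by measurable
  have g_bound: "0 \<le> g y z" "g y z \<le> (2 * B)\<^sup>2" for y z
  proof -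
    have "\<bar>f (z + y) - f z\<bar> \<le> 2 * B" using f(2)[of "z + y"] f(2)[of z] by linarith
    then show "g y z \<le> (2 * B)\<^sup>2" unfolding g_def by (metis power2_abs abs_ge_zero power_mono)
  qed (simp add: g_def)
  have g_int: "integrable \<sigma> (g y)" for y
    by (rule \<sigma>.integrable_const_bound[of _ "(2 * B)\<^sup>2"]) (use g_bound in simp_all)
  have Pg_bound: "0 \<le> mehler_op T \<mu> t (g y) x" "mehler_op T \<mu> t (g y) x \<le> (2 * B)\<^sup>2" for x y
  proof -
    show "0 \<le> mehler_op T \<mu> t (g y) x" unfolding mehler_op_def by (simp add: g_bound integral_nonneg_AE)
    have "mehler_op T \<mu> t (g y) x \<le> (LINT z|\<mu> t. (2 * B)\<^sup>2)"
      unfolding mehler_op_def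
      by (intro integral_mono \<mu>.integrable_const_bound[of _ "(2 * B)\<^sup>2"]) (use g_bound in simp_all)
    then show "mehler_op T \<mu> t (g y) x \<le> (2 * B)\<^sup>2" by (simp add: \<mu>.prob_space)
  qed
  have Pg_int: "integrable \<sigma> (mehler_op T \<mu> t (g y))" for y
    by (rule \<sigma>.integrable_const_bound[of _ "(2 * B)\<^sup>2"])
      (use Pg_bound mehler_op_measurable[OF t g_meas1] in \<open>simp_all add: measurable_cong_sets[OF sets_\<sigma> refl]\<close>)
  have Pg_meas: "(\<lambda>(x, y). ennreal (mehler_op T \<mu> t (g (T t y)) x)) \<in> borel_measurable (\<sigma> \<Otimes>\<^sub>M M)"
  proof -
    have "(\<lambda>p. LINT z|\<mu> t. g (T t (snd p)) (T t (fst p) + z)) \<in> borel_measurable (\<sigma> \<Otimes>\<^sub>M M)"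
      unfolding g_def by (intro \<mu>.borel_measurable_lebesgue_integral) measurable
    then show ?thesis unfolding mehler_op_def split_beta by measurable
  qed
  \<comment> \<open>The mean squared increment under \<sigma> as a function of the jump; both sides
    of the estimate are M-integrals of it.\<close>
  define w where "w y = ennreal (LINT x|\<sigma>. g y x)" for y
  have w: "w y = (\<integral>\<^sup>+x. ennreal (g y x) \<partial>\<sigma>)" for y
    unfolding w_def using g_bound by (intro nn_integral_eq_integral[symmetric] g_int) simp
  have w_meas: "w \<in> borel_measurable borel"
    unfolding w[abs_def] g_def by (intro \<sigma>.borel_measurable_nn_integral) measurable
  obtain K' where K': "jump_bounded K' ?P" using mehler_op_jump_bounded[OF t f] by blast
  have "ennreal (energy M \<sigma> ?P) = (\<integral>\<^sup>+x. \<integral>\<^sup>+y. ennreal ((?P (x + y) - ?P x)\<^sup>2) \<partial>M \<partial>\<sigma>)"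
    by (rule ennreal_energy[OF K'])
  also have "\<dots> \<le> (\<integral>\<^sup>+x. \<integral>\<^sup>+y. ennreal (mehler_op T \<mu> t (g (T t y)) x) \<partial>M \<partial>\<sigma>)"
    unfolding g_def by (intro nn_integral_mono ennreal_leI mehler_op_jump_le[OF t meas f(2)])
  also have "\<dots> = (\<integral>\<^sup>+y. \<integral>\<^sup>+x. ennreal (mehler_op T \<mu> t (g (T t y)) x) \<partial>\<sigma> \<partial>M)"
    by (rule \<sigma>M.Fubini'[OF Pg_meas, symmetric])
  also have "\<dots> = (\<integral>\<^sup>+y. w (T t y) \<partial>M)"
  proof (intro nn_integral_cong)
    fix y
    have "bounded (range (g (T t y)))"
      using g_bound by (auto simp: bounded_iff intro!: exI[of _ "(2 * B)\<^sup>2"])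
    then have "(LINT x|\<sigma>. mehler_op T \<mu> t (g (T t y)) x) = (LINT x|\<sigma>. g (T t y) x)"
      by (intro invariant_eq t g_meas1)
    then show "(\<integral>\<^sup>+x. ennreal (mehler_op T \<mu> t (g (T t y)) x) \<partial>\<sigma>) = w (T t y)"
      unfolding w_def using Pg_bound by (subst nn_integral_eq_integral[OF Pg_int]) simp_all
  qed
  also have "\<dots> \<le> ennreal c * (\<integral>\<^sup>+y. w y \<partial>M)" by (rule dom[OF w_meas])
  also have "(\<integral>\<^sup>+y. w y \<partial>M) = (\<integral>\<^sup>+x. \<integral>\<^sup>+y. ennreal (g y x) \<partial>M \<partial>\<sigma>)"
    unfolding w g_def by (rule \<sigma>M.Fubini') measurable
  also have "\<dots> = ennreal (energy M \<sigma> f)"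
    unfolding g_def by (rule ennreal_energy[OF f(1), symmetric])
  also have "ennreal c * \<dots> = ennreal (c * energy M \<sigma> f)"
    by (rule ennreal_mult'[symmetric, OF c])
  finally have "ennreal (energy M \<sigma> ?P) \<le> ennreal (c * energy M \<sigma> f)" .
  moreover have "0 \<le> c * energy M \<sigma> f"
    using c unfolding energy_def by (intro mult_nonneg_nonneg integral_nonneg_AE AE_I2) auto
  ultimately show ?thesis by (simp add: ennreal_le_iff)
qed

end

section \<open>Integration in time: the variance inequality for trigonometric and cylindrical
  functions\<close>

locale dominated_levy_mehler = levy_mehler +
  fixes h :: "real \<Rightarrow> real" and C :: real
  assumes decay: "\<And>x. ((\<lambda>t. T t x) \<longlongrightarrow> 0) at_top"
    and h_pos: "\<And>t. t > 0 \<Longrightarrow> h t > 0"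
    and h_int: "set_integrable lebesgue {0<..} h"
    and dominated: "\<And>t. t > 0 \<Longrightarrow>
      positive_measure_difference (scale_measure (ennreal (h t)) M) (distr M borel (T t))"
    and C_eq: "C = (LINT t:{0<..}|lebesgue. \<bar>h t\<bar>)"
begin

text \<open>Passes from the comparison of measures to integrals of nonnegative functions, by
  discarding the remainder measure \<open>N\<close>.\<close>

lemma nn_integral_dominated:
  assumes t: "t > 0" and w: "w \<in> borel_measurable borel"
  shows "(\<integral>\<^sup>+y. w (T t y) \<partial>M) \<le> ennreal (h t) * (\<integral>\<^sup>+y. w y \<partial>M)"
proof -
  let ?D = "distr M borel (T t)" and ?S = "scale_measure (ennreal (h t)) M"
  obtain N where N: "\<And>B. B \<in> sets borel \<Longrightarrow> emeasure ?S B = emeasure ?D B + emeasure N B"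
    using dominated[OF t] by (auto simp: positive_measure_difference_def)
  have sets_eq: "sets ?D = sets ?S" by simp
  have "emeasure ?D B \<le> emeasure ?S B" for B
  \<comment> \<open>The order on measures compares values on all sets; on non-measurable ones
    \<open>emeasure\<close> is 0.\<close>
  proof (cases "B \<in> sets borel")
    case False
    then show ?thesis by (simp add: emeasure_notin_sets)
  qed (simp only: N, simp)
  then have "?D \<le> ?S"
    unfolding le_measure_iff using sets_eq sets_eq_imp_space_eq[OF sets_eq] by (simp add: le_fun_def)
  then have "nn_integral ?D w \<le> nn_integral ?S w" by (rule nn_integral_mono_measure[OF sets_eq])
  then show ?thesis
    using t w T_measurable[of t]
    by (simp add: nn_integral_distr measurable_cong_sets[OF sets_M refl] nn_integral_scale_measure)
qed

text \<open>Rewrites the norm of \<open>h\<close> as a gauge integral, the kind in which the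
  fundamental theorem of calculus delivers the integral of the energy.\<close>

lemma C_eq_integral: "C = integral {0<..} h"
proof -
  have "C = (LINT t:{0<..}|lebesgue. h t)"
    unfolding C_eq set_lebesgue_integral_def
    by (intro Bochner_Integration.integral_cong refl) (auto simp: indicator_def h_pos less_imp_le)
  then show ?thesis using set_lebesgue_integral_eq_integral(2)[OF h_int] by simp
qed

lemma C_nonneg: "C \<ge> 0"
  unfolding C_eq set_lebesgue_integral_def by (intro integral_nonneg_AE AE_I2) (simp add: indicator_def)

lemma poincare_trig_poly:
  assumes f: "trig_poly f" "\<And>x. \<bar>f x\<bar> \<le> K" "\<And>x y. \<bar>f (x + y) - f x\<bar> \<le> K * norm y"
    and meas: "f \<in> borel_measurable borel"
  shows "(LINT x|\<sigma>. (f x)\<^sup>2) - (LINT x|\<sigma>. f x)\<^sup>2 \<le> C * energy M \<sigma> f"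
proof -
  obtain n c \<xi> where rep: "\<And>x. complex_of_real (f x) = (\<Sum>i<n::nat. c i * iexp (x \<bullet> \<xi> i))"
    using exp_sums_expand[OF f(1)[unfolded trig_poly_def]] by blast
  note jb = jump_bounded_lipschitz[OF meas f(2,3)]
  define V where "V t = (LINT x|\<sigma>. (mehler_op T \<mu> t f x)\<^sup>2)" for t
  define E where "E t = energy M \<sigma> (mehler_op T \<mu> t f)" for t
  \<comment> \<open>\<open>S\<close> equals V for \<open>t \<ge> 0\<close> and can be differentiated
    term by term; real parts lead back to V.\<close>
  define S where "S t = (\<Sum>i<n. \<Sum>j<n. c i * c j * mixed t (\<xi> i) (\<xi> j))" for t
  have VS: "complex_of_real (V t) = S t" if "t \<ge> 0" for t
    unfolding V_def S_def by (rule mehler_op_square_exp_sum[OF rep that])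
  have V_deriv: "(V has_vector_derivative - E t) (at t within {0..t0})" if t: "t \<in> {0..t0}" for t t0
  proof -
    have "(S has_vector_derivative (\<Sum>i<n. \<Sum>j<n. c i * c j * - (cross (\<xi> i) (\<xi> j) t * mixed t (\<xi> i) (\<xi> j))))
        (at t within {0..t0})"
      unfolding S_def
      by (intro has_vector_derivative_sum has_vector_derivative_mult_right mixed_has_derivative t)
    also have "(\<Sum>i<n. \<Sum>j<n. c i * c j * - (cross (\<xi> i) (\<xi> j) t * mixed t (\<xi> i) (\<xi> j))) = complex_of_real (- E t)"
      using t mehler_op_energy_exp_sum[OF rep, of t] by (simp add: E_def sum_negf)
    finally have "((\<lambda>t. Re (S t)) has_vector_derivative Re (complex_of_real (- E t))) (at t within {0..t0})"
      by (rule bounded_linear.has_vector_derivative[OF bounded_linear_Re])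
    then have "((\<lambda>t. Re (S t)) has_vector_derivative - E t) (at t within {0..t0})" by simp
    then show ?thesis
      by (rule has_vector_derivative_transform[rotated 2]) (use t in \<open>simp_all add: VS[symmetric]\<close>)
  qed
  have V_le: "V 0 - V t \<le> C * energy M \<sigma> f" if t: "t \<ge> 0" for t
  proof -
    \<comment> \<open>Integrability of \<open>E\<close> comes for free here, because it is minus a
      derivative.\<close>
    have "((\<lambda>s. - E s) has_integral (V t - V 0)) {0..t}"
      by (intro fundamental_theorem_of_calculus t V_deriv)
    then have "(E has_integral (V 0 - V t)) {0..t}"
      using has_integral_neg[of "\<lambda>s. - E s" "V t - V 0" "{0..t}"] by simp
    \<comment> \<open>Domination is available for positive times only, so the endpoint 0 is taken
      off.\<close>
    moreover have "negligible {x \<in> {0..t} - {0<..t}. E x \<noteq> 0}"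
      by (rule negligible_subset[OF negligible_sing[of 0]]) auto
    moreover have "negligible {x \<in> {0<..t} - {0..t}. E x \<noteq> 0}"
      by (rule negligible_subset[OF negligible_sing[of 0]]) auto
    ultimately have int_E: "(E has_integral (V 0 - V t)) {0<..t}"
      by (rule iffD1[OF has_integral_spike_set_eq, rotated 2])
    have "set_integrable lebesgue {0<..t} h" by (rule set_integrable_subset[OF h_int]) auto
    then have "h integrable_on {0<..t}" by (rule set_lebesgue_integral_eq_integral(1))
    then have int_h: "((\<lambda>s. h s * energy M \<sigma> f) has_integral (integral {0<..t} h * energy M \<sigma> f)) {0<..t}"
      by (intro has_integral_mult_left integrable_integral)
    have "V 0 - V t \<le> integral {0<..t} h * energy M \<sigma> f"
    proof (rule has_integral_le[OF int_E int_h])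
      fix s assume "s \<in> {0<..t}"
      then show "E s \<le> h s * energy M \<sigma> f"
        unfolding E_def
        by (intro energy_mehler_op_le[OF _ jb f(2)] nn_integral_dominated) (auto simp: h_pos less_imp_le)
    qed
    also have "\<dots> \<le> C * energy M \<sigma> f"
    proof (rule mult_right_mono)
      show "integral {0<..t} h \<le> C"
        unfolding C_eq_integral using \<open>h integrable_on {0<..t}\<close> set_lebesgue_integral_eq_integral(1)[OF h_int]
        by (intro integral_subset_le) (auto simp: h_pos less_imp_le)
      show "0 \<le> energy M \<sigma> f" unfolding energy_def by (intro integral_nonneg_AE AE_I2) auto
    qed
    finally show ?thesis .
  qed
  have mean: "complex_of_real (LINT x|\<sigma>. f x) = (\<Sum>i<n. c i * sigmahat 0 (\<xi> i))"
  proof -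
    have "complex_of_real (LINT x|\<sigma>. f x) = (LINT x|\<sigma>. complex_of_real (f x))" by simp
    also have "\<dots> = (\<Sum>i<n. (LINT x|\<sigma>. c i * iexp (T 0 x \<bullet> \<xi> i)))"
      unfolding rep T_0
      by (intro Bochner_Integration.integral_sum integrable_mult_right iexp_\<sigma>_integrable[of 0, unfolded T_0]) simp
    finally show ?thesis by (simp add: sigmahat_def)
  qed
  have "(S \<longlongrightarrow> (\<Sum>i<n. \<Sum>j<n. c i * c j * (sigmahat 0 (\<xi> i) * sigmahat 0 (\<xi> j)))) at_top"
    unfolding S_def by (intro tendsto_intros mixed_tendsto decay)
  also have "(\<Sum>i<n. \<Sum>j<n. c i * c j * (sigmahat 0 (\<xi> i) * sigmahat 0 (\<xi> j))) = complex_of_real ((LINT x|\<sigma>. f x)\<^sup>2)"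
  proof -
    have "complex_of_real ((LINT x|\<sigma>. f x)\<^sup>2) = (\<Sum>i<n. c i * sigmahat 0 (\<xi> i)) * (\<Sum>i<n. c i * sigmahat 0 (\<xi> i))"
      by (simp only: of_real_mult mean power2_eq_square)
    then show ?thesis by (simp only: sum_product mult_ac)
  qed
  finally have "((\<lambda>t. Re (S t)) \<longlongrightarrow> (LINT x|\<sigma>. f x)\<^sup>2) at_top"
    using tendsto_Re by fastforce
  then have "(V \<longlongrightarrow> (LINT x|\<sigma>. f x)\<^sup>2) at_top"
  proof (rule Lim_transform_eventually)
    show "\<forall>\<^sub>F t in at_top. Re (S t) = V t"
      using eventually_ge_at_top[of 0] by eventually_elim (simp add: VS[symmetric])
  qed
  then have "((\<lambda>t. V 0 - V t) \<longlongrightarrow> V 0 - (LINT x|\<sigma>. f x)\<^sup>2) at_top" by (intro tendsto_intros)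
  then have "V 0 - (LINT x|\<sigma>. f x)\<^sup>2 \<le> C * energy M \<sigma> f"
  proof (rule tendsto_upperbound)
    show "\<forall>\<^sub>F t in at_top. V 0 - V t \<le> C * energy M \<sigma> f"
      using eventually_ge_at_top[of 0] by eventually_elim (rule V_le)
  qed simp
  \<comment> \<open>\<open>\<mu> 0\<close> is known only through its characteristic function, so P_0
    f = f is checked on the exponential expansion.\<close>
  moreover have "mehler_op T \<mu> 0 f x = f x" for x
  proof -
    have "complex_of_real (mehler_op T \<mu> 0 f x) = complex_of_real (f x)"
      unfolding rep by (subst mehler_op_exp_sum[OF rep]) (simp_all add: muhat_0 T_0)
    then show ?thesis by simp
  qed
  ultimately show ?thesis by (simp add: V_def)
qed

text \<open>Dominated convergence twice in the energy: the jump bound dominates the inner integrals,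
  and its M-integral is a constant bound for the outer one under the probability measure
  \<sigma>.\<close>

lemma poincare_FC2:
  assumes "F \<in> FC2 d e"
  shows "(LINT x|\<sigma>. (F x)\<^sup>2) - (LINT x|\<sigma>. F x)\<^sup>2 \<le> C * energy M \<sigma> F"
proof -
  obtain g K where g: "\<And>m. trig_poly (g m)" "\<And>m x. \<bar>g m x\<bar> \<le> K"
    "\<And>m x y. \<bar>g m (x + y) - g m x\<bar> \<le> K * norm y" and lim: "\<And>x. (\<lambda>m. g m x) \<longlonglongrightarrow> F x"
    by (rule FC2_trig_poly_approx[OF assms]) blast
  have meas[measurable]: "g m \<in> borel_measurable borel" for m
    by (rule lipschitz_borel_measurable[OF g(3)])
  have [measurable]: "F \<in> borel_measurable borel"
    by (rule borel_measurable_LIMSEQ_real[OF lim]) simp_all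
  note jb = jump_bounded_lipschitz[OF meas g(2,3)]
  have jump_le: "(g m (x + y) - g m x)\<^sup>2 \<le> 4 * K\<^sup>2 * min 1 ((norm y)\<^sup>2)" for m x y
    using jb by (simp add: jump_bounded_def)
  let ?I = "LINT y|M. min 1 ((norm y)\<^sup>2)"
  have inner: "(\<lambda>m. LINT y|M. (g m (x + y) - g m x)\<^sup>2) \<longlonglongrightarrow> (LINT y|M. (F (x + y) - F x)\<^sup>2)" for x
  proof (rule integral_dominated_convergence[where w = "\<lambda>y. 4 * K\<^sup>2 * min 1 ((norm y)\<^sup>2)"])
    show "integrable M (\<lambda>y. 4 * K\<^sup>2 * min 1 ((norm y)\<^sup>2))"
      by (intro integrable_mult_right levy_measure_integrable_min levy)
    show "AE y in M. (\<lambda>m. (g m (x + y) - g m x)\<^sup>2) \<longlonglongrightarrow> (F (x + y) - F x)\<^sup>2"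
      by (intro AE_I2 tendsto_intros lim)
    show "AE y in M. norm ((g m (x + y) - g m x)\<^sup>2) \<le> 4 * K\<^sup>2 * min 1 ((norm y)\<^sup>2)" for m
      using jump_le by (intro AE_I2) simp
  qed measurable
  have "(\<lambda>m. energy M \<sigma> (g m)) \<longlonglongrightarrow> energy M \<sigma> F"
    unfolding energy_square
  proof (rule integral_dominated_convergence[where w = "\<lambda>_. 4 * K\<^sup>2 * ?I"])
    show "(\<lambda>x. LINT y|M. (F (x + y) - F x)\<^sup>2) \<in> borel_measurable \<sigma>"
      "(\<lambda>x. LINT y|M. (g m (x + y) - g m x)\<^sup>2) \<in> borel_measurable \<sigma>" for m
      by (intro M.borel_measurable_lebesgue_integral jump_measurable_pair; measurable)+
    show "AE x in \<sigma>. norm (LINT y|M. (g m (x + y) - g m x)\<^sup>2) \<le> 4 * K\<^sup>2 * ?I" for m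
      using jump_integral_le[OF jb] by (intro AE_I2) simp
    show "AE x in \<sigma>. (\<lambda>m. LINT y|M. (g m (x + y) - g m x)\<^sup>2) \<longlonglongrightarrow> (LINT y|M. (F (x + y) - F x)\<^sup>2)"
      by (intro AE_I2 inner)
  qed simp
  then have "(\<lambda>m. C * energy M \<sigma> (g m)) \<longlonglongrightarrow> C * energy M \<sigma> F" by (intro tendsto_intros)
  moreover have "(\<lambda>m. LINT x|\<sigma>. g m x) \<longlonglongrightarrow> (LINT x|\<sigma>. F x)"
    by (rule integral_dominated_convergence[where w = "\<lambda>_. K"]) (use g(2) lim in auto)
  moreover have "(\<lambda>m. LINT x|\<sigma>. (g m x)\<^sup>2) \<longlonglongrightarrow> (LINT x|\<sigma>. (F x)\<^sup>2)"
  proof (rule integral_dominated_convergence[where w = "\<lambda>_. K\<^sup>2"])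
    have "(g m x)\<^sup>2 \<le> K\<^sup>2" for m x using g(2)[of m x] by (metis power2_abs abs_ge_zero power_mono)
    then show "AE x in \<sigma>. norm ((g m x)\<^sup>2) \<le> K\<^sup>2" for m by simp
    show "AE x in \<sigma>. (\<lambda>m. (g m x)\<^sup>2) \<longlonglongrightarrow> (F x)\<^sup>2" by (intro AE_I2 tendsto_intros lim)
  qed simp_all
  ultimately show ?thesis
    by (intro LIMSEQ_le[OF tendsto_diff[OF _ tendsto_power]])
      (use poincare_trig_poly[OF g(1,2,3) meas] in auto)
qed

end

section \<open>Extension to the completion\<close>

text \<open>Young's inequality with a weight. Being linear in the squares, it can be integrated,
  once for the L2 norm and twice for the energy.\<close>

lemma square_sum_le:
  fixes u v \<epsilon> :: real
  assumes "\<epsilon> > 0"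
  shows "(u + v)\<^sup>2 \<le> (1 + \<epsilon>) * u\<^sup>2 + (1 + 1 / \<epsilon>) * v\<^sup>2"
proof -
  have "0 \<le> (\<epsilon> * u - v)\<^sup>2 / \<epsilon>" using assms by simp
  also have "\<dots> = \<epsilon> * u\<^sup>2 - 2 * u * v + v\<^sup>2 / \<epsilon>"
    using assms by (simp add: field_simps power2_eq_square)
  finally show ?thesis by (simp add: algebra_simps power2_eq_square)
qed

text \<open>Minkowski's inequality follows from a family of quadratic bounds by choosing \<open>\<epsilon> = sqrt b / sqrt a\<close>.\<close>

lemma sqrt_le_add_sqrt:
  assumes "a \<ge> 0" "b \<ge> 0" and le: "\<And>\<epsilon>. \<epsilon> > 0 \<Longrightarrow> c \<le> (1 + \<epsilon>) * a + (1 + 1 / \<epsilon>) * b"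
  shows "sqrt c \<le> sqrt a + sqrt b"
proof (rule field_le_epsilon)
  fix \<delta> :: real assume "\<delta> > 0"
  \<comment> \<open>Padding by half of \<open>\<delta>\<close> keeps the ratio \<open>B / A\<close>
    defined and positive when a root vanishes.\<close>
  define A B where "A = sqrt a + \<delta> / 2" and "B = sqrt b + \<delta> / 2"
  have AB: "A > 0" "B > 0" using assms \<open>\<delta> > 0\<close> by (simp_all add: A_def B_def add_nonneg_pos)
  have "(sqrt a)\<^sup>2 \<le> A\<^sup>2" "(sqrt b)\<^sup>2 \<le> B\<^sup>2"
    unfolding A_def B_def using assms \<open>\<delta> > 0\<close> by (intro power_mono; simp)+
  then have "a \<le> A\<^sup>2" "b \<le> B\<^sup>2" using assms by simp_all
  have "c \<le> (1 + B / A) * a + (1 + 1 / (B / A)) * b" using AB by (intro le) simp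
  also have "\<dots> \<le> (1 + B / A) * A\<^sup>2 + (1 + 1 / (B / A)) * B\<^sup>2"
    using AB \<open>a \<le> A\<^sup>2\<close> \<open>b \<le> B\<^sup>2\<close> by (intro add_mono mult_left_mono) auto
  also have "\<dots> = (A + B)\<^sup>2" using AB by (simp add: field_simps power2_eq_square)
  finally have "sqrt c \<le> A + B" using AB by (simp add: real_le_lsqrt)
  then show "sqrt c \<le> sqrt a + sqrt b + \<delta>" by (simp add: A_def B_def)
qed

lemma square_integrable_add:
  assumes "square_integrable N f" "square_integrable N g"
  shows "square_integrable N (\<lambda>x. f x + g x)"
proof -
  have [measurable]: "f \<in> borel_measurable N" "g \<in> borel_measurable N"
    using assms by (simp_all add: square_integrable_def)
  have "integrable N (\<lambda>x. (f x + g x)\<^sup>2)"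
  proof (rule Bochner_Integration.integrable_bound)
    show "integrable N (\<lambda>x. 2 * (f x)\<^sup>2 + 2 * (g x)\<^sup>2)"
      using assms by (auto simp: square_integrable_def)
    show "AE x in N. norm ((f x + g x)\<^sup>2) \<le> norm (2 * (f x)\<^sup>2 + 2 * (g x)\<^sup>2)"
      using square_sum_le[of 1] by (intro AE_I2) simp
  qed measurable
  then show ?thesis by (simp add: square_integrable_def)
qed

lemma square_integrable_diff:
  assumes "square_integrable N f" "square_integrable N g"
  shows "square_integrable N (\<lambda>x. f x - g x)"
  using square_integrable_add[of N f "\<lambda>x. - g x"] assms by (simp add: square_integrable_def)

lemma (in finite_measure) square_integrable_bounded:
  assumes "f \<in> borel_measurable M" "\<And>x. \<bar>f x\<bar> \<le> K"
  shows "square_integrable M f"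
proof -
  have "(f x)\<^sup>2 \<le> K\<^sup>2" for x using assms(2)[of x] by (metis power2_abs abs_ge_zero power_mono)
  then have "integrable M (\<lambda>x. (f x)\<^sup>2)"
    using assms(1) by (intro integrable_const_bound[of _ "K\<^sup>2"]) simp_all
  then show ?thesis using assms(1) by (simp add: square_integrable_def)
qed

lemma (in prob_space) square_integrable_imp_integrable':
  assumes "square_integrable M f"
  shows "integrable M f"
proof (rule square_integrable_imp_integrable)
  show "f \<in> borel_measurable M" "integrable M (\<lambda>x. (f x)\<^sup>2)"
    using assms by (simp_all add: square_integrable_def)
qed

lemma L2_norm_triangle:
  assumes "square_integrable N f" "square_integrable N g"
  shows "L2_norm N (\<lambda>x. f x + g x) \<le> L2_norm N f + L2_norm N g"
  unfolding L2_norm_def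
proof (rule sqrt_le_add_sqrt)
  fix \<epsilon> :: real assume "\<epsilon> > 0"
  have int: "integrable N (\<lambda>x. (f x)\<^sup>2)" "integrable N (\<lambda>x. (g x)\<^sup>2)"
    using assms by (simp_all add: square_integrable_def)
  have "(LINT x|N. (f x + g x)\<^sup>2) \<le> (LINT x|N. (1 + \<epsilon>) * (f x)\<^sup>2 + (1 + 1 / \<epsilon>) * (g x)\<^sup>2)"
    using int \<open>\<epsilon> > 0\<close> by (intro integral_mono' square_sum_le) auto
  then show "(LINT x|N. (f x + g x)\<^sup>2) \<le> (1 + \<epsilon>) * (LINT x|N. (f x)\<^sup>2) + (1 + 1 / \<epsilon>) * (LINT x|N. (g x)\<^sup>2)"
    using int by simp
qed simp_all

lemma L2_norm_minus_commute: "L2_norm N (\<lambda>x. f x - g x) = L2_norm N (\<lambda>x. g x - f x)"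
  by (simp add: L2_norm_def power2_commute)

lemma (in prob_space) L2_norm_centered:
  assumes "square_integrable M f"
  shows "L2_norm M (\<lambda>x. f x - expectation f) = sqrt (expectation (\<lambda>x. (f x)\<^sup>2) - (expectation f)\<^sup>2)"
  unfolding L2_norm_def
  using variance_eq[OF square_integrable_imp_integrable'[OF assms]] assms by (simp add: square_integrable_def)

lemma (in prob_space) abs_expectation_le_L2_norm:
  assumes "square_integrable M f"
  shows "\<bar>expectation f\<bar> \<le> L2_norm M f"
  unfolding L2_norm_def
  using square_expectation_le[OF square_integrable_imp_integrable'[OF assms]] assms
  by (intro real_le_rsqrt) (simp add: square_integrable_def)

text \<open>The factor 2 counts one error from replacing the function and one from replacing its
  mean, the latter bounded by Jensen.\<close>

lemma (in prob_space) L2_norm_centered_le: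
  assumes f: "square_integrable M f" and g: "square_integrable M g"
  shows "L2_norm M (\<lambda>x. g x - expectation g) \<le> L2_norm M (\<lambda>x. f x - expectation f) + 2 * L2_norm M (\<lambda>x. f x - g x)"
proof -
  have const: "square_integrable M (\<lambda>_. c)" for c by (simp add: square_integrable_def)
  note sq = square_integrable_diff[OF g f] square_integrable_diff[OF f g] square_integrable_diff[OF f const]
  have "L2_norm M (\<lambda>x. g x - expectation g)
      = L2_norm M (\<lambda>x. (g x - f x) + ((f x - expectation f) + (expectation f - expectation g)))"
    by (simp add: L2_norm_def)
  also have "\<dots> \<le> L2_norm M (\<lambda>x. g x - f x) + (L2_norm M (\<lambda>x. f x - expectation f)
      + L2_norm M (\<lambda>_. expectation f - expectation g))"
    by (rule order_trans[OF L2_norm_triangle add_left_mono[OF L2_norm_triangle]])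
      (intro sq const square_integrable_add)+
  also have "L2_norm M (\<lambda>_. expectation f - expectation g) = \<bar>expectation (\<lambda>x. f x - g x)\<bar>"
    using f g by (simp add: L2_norm_def prob_space square_integrable_imp_integrable')
  also have "\<dots> \<le> L2_norm M (\<lambda>x. f x - g x)" by (rule abs_expectation_le_L2_norm[OF sq(2)])
  finally show ?thesis by (simp add: L2_norm_minus_commute[of M g f])
qed

section \<open>The energy seminorm on cylindrical functions and on the completion\<close>

context levy_mehler
begin

lemma energy_nonneg: "energy M \<sigma> g \<ge> 0"
  unfolding energy_def by (intro integral_nonneg_AE AE_I2) auto

text \<open>Minkowski's inequality for increments, carried out on the iterated integral; the jump
  bounds provide integrability at each of the two levels.\<close>

lemma sqrt_energy_triangle:
  assumes f: "jump_bounded K f" and g: "jump_bounded L g"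
  shows "sqrt (energy M \<sigma> (\<lambda>x. f x + g x)) \<le> sqrt (energy M \<sigma> f) + sqrt (energy M \<sigma> g)"
proof (rule sqrt_le_add_sqrt[OF energy_nonneg energy_nonneg])
  fix \<epsilon> :: real assume "\<epsilon> > 0"
  let ?f = "\<lambda>x y. (f (x + y) - f x)\<^sup>2" and ?g = "\<lambda>x y. (g (x + y) - g x)\<^sup>2"
  have "(LINT y|M. (f (x + y) + g (x + y) - (f x + g x))\<^sup>2)
      \<le> (LINT y|M. (1 + \<epsilon>) * ?f x y + (1 + 1 / \<epsilon>) * ?g x y)" for x
  proof (rule integral_mono')
    show "(f (x + y) + g (x + y) - (f x + g x))\<^sup>2 \<le> (1 + \<epsilon>) * ?f x y + (1 + 1 / \<epsilon>) * ?g x y" for y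
      using square_sum_le[OF \<open>\<epsilon> > 0\<close>, of "f (x + y) - f x" "g (x + y) - g x"] by (simp add: algebra_simps)
    show "integrable M (\<lambda>y. (1 + \<epsilon>) * ?f x y + (1 + 1 / \<epsilon>) * ?g x y)"
      by (intro Bochner_Integration.integrable_add integrable_mult_right
          jump_integrable[OF f] jump_integrable[OF g])
  qed (use \<open>\<epsilon> > 0\<close> in simp)
  also have "(LINT y|M. (1 + \<epsilon>) * ?f x y + (1 + 1 / \<epsilon>) * ?g x y)
      = (1 + \<epsilon>) * (LINT y|M. ?f x y) + (1 + 1 / \<epsilon>) * (LINT y|M. ?g x y)" for x
    using jump_integrable[OF f, of x] jump_integrable[OF g, of x] by simp
  finally have le: "(LINT y|M. (f (x + y) + g (x + y) - (f x + g x))\<^sup>2)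
      \<le> (1 + \<epsilon>) * (LINT y|M. ?f x y) + (1 + 1 / \<epsilon>) * (LINT y|M. ?g x y)" for x .
  have "energy M \<sigma> (\<lambda>x. f x + g x)
      \<le> (LINT x|\<sigma>. (1 + \<epsilon>) * (LINT y|M. ?f x y) + (1 + 1 / \<epsilon>) * (LINT y|M. ?g x y))"
    unfolding energy_square
  proof (rule integral_mono'[OF _ le])
    show "integrable \<sigma> (\<lambda>x. (1 + \<epsilon>) * (LINT y|M. ?f x y) + (1 + 1 / \<epsilon>) * (LINT y|M. ?g x y))"
      by (intro Bochner_Integration.integrable_add integrable_mult_right
          jump_integral_integrable[OF f] jump_integral_integrable[OF g])
  qed (use \<open>\<epsilon> > 0\<close> in \<open>auto intro!: add_nonneg_nonneg mult_nonneg_nonneg integral_nonneg_AE\<close>)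
  then show "energy M \<sigma> (\<lambda>x. f x + g x) \<le> (1 + \<epsilon>) * energy M \<sigma> f + (1 + 1 / \<epsilon>) * energy M \<sigma> g"
    unfolding energy_square using jump_integral_integrable[OF f] jump_integral_integrable[OF g] by simp
qed

lemma sqrt_energy_diff_le:
  assumes "jump_bounded K f" "jump_bounded L g" "jump_bounded K' (\<lambda>x. f x - g x)" "jump_bounded L' (\<lambda>x. g x - f x)"
  shows "\<bar>sqrt (energy M \<sigma> f) - sqrt (energy M \<sigma> g)\<bar> \<le> sqrt (energy M \<sigma> (\<lambda>x. f x - g x))"
proof -
  have "(f (x + y) - g (x + y) - (f x - g x))\<^sup>2 = (g (x + y) - f (x + y) - (g x - f x))\<^sup>2" for x y
    by (simp add: algebra_simps power2_eq_square)
  then have "energy M \<sigma> (\<lambda>x. g x - f x) = energy M \<sigma> (\<lambda>x. f x - g x)"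
    by (simp add: energy_square)
  then show ?thesis
    using sqrt_energy_triangle[OF assms(3,2)] sqrt_energy_triangle[OF assms(4,1)] by simp
qed

lemma FC2_jump_bounded:
  assumes "F \<in> FC2 d e"
  shows "\<exists>K. jump_bounded K F"
proof -
  obtain K where K: "\<And>x. \<bar>F x\<bar> \<le> K" "\<And>x y. \<bar>F (x + y) - F x\<bar> \<le> K * norm y"
    using FC2_bounds[OF assms] by blast
  show ?thesis using jump_bounded_lipschitz[OF lipschitz_borel_measurable[OF K(2)] K] by blast
qed

text \<open>Differences are treated through the sup and Lipschitz bounds, which simply add, instead
  of merging two cylindrical representations into one.\<close>

lemma FC2_diff_jump_bounded:
  assumes "F \<in> FC2 d e" "G \<in> FC2 d e"
  shows "\<exists>K. jump_bounded K (\<lambda>x. F x - G x)"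
proof -
  obtain K where K: "\<And>x. \<bar>F x\<bar> \<le> K" "\<And>x y. \<bar>F (x + y) - F x\<bar> \<le> K * norm y"
    using FC2_bounds[OF assms(1)] by blast
  obtain L where L: "\<And>x. \<bar>G x\<bar> \<le> L" "\<And>x y. \<bar>G (x + y) - G x\<bar> \<le> L * norm y"
    using FC2_bounds[OF assms(2)] by blast
  have "\<bar>F x - G x\<bar> \<le> K + L" for x using K(1)[of x] L(1)[of x] by linarith
  moreover have lip: "\<bar>(F (x + y) - G (x + y)) - (F x - G x)\<bar> \<le> (K + L) * norm y" for x y
    using K(2)[of x y] L(2)[of x y] unfolding distrib_right by linarith
  ultimately show ?thesis
    using jump_bounded_lipschitz[OF lipschitz_borel_measurable[OF lip]] by blast
qed

lemma FC2_sqrt_energy_diff_le: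
  assumes "F \<in> FC2 d e" "G \<in> FC2 d e"
  shows "\<bar>sqrt (energy M \<sigma> F) - sqrt (energy M \<sigma> G)\<bar> \<le> H2_norm M \<sigma> (\<lambda>x. F x - G x)"
proof -
  have "0 \<le> L2_norm \<sigma> (\<lambda>x. F x - G x)" by (simp add: L2_norm_def)
  moreover obtain K L where "jump_bounded K F" "jump_bounded L G"
    using FC2_jump_bounded[OF assms(1)] FC2_jump_bounded[OF assms(2)] by blast
  moreover obtain K' L' where "jump_bounded K' (\<lambda>x. F x - G x)" "jump_bounded L' (\<lambda>x. G x - F x)"
    using FC2_diff_jump_bounded[OF assms] FC2_diff_jump_bounded[OF assms(2,1)] by blast
  ultimately have "0 \<le> L2_norm \<sigma> (\<lambda>x. F x - G x)" "\<bar>sqrt (energy M \<sigma> F) - sqrt (energy M \<sigma> G)\<bar> \<le> sqrt (energy M \<sigma> (\<lambda>x. F x - G x))"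
    by (simp_all add: sqrt_energy_diff_le)
  then show ?thesis by (simp add: H2_norm_def)
qed

lemma FC2_square_integrable:
  assumes "F \<in> FC2 d e"
  shows "square_integrable \<sigma> F"
proof -
  obtain K where K: "\<And>x. \<bar>F x\<bar> \<le> K" "\<And>x y. \<bar>F (x + y) - F x\<bar> \<le> K * norm y"
    using FC2_bounds[OF assms] by blast
  have [measurable]: "F \<in> borel_measurable borel" by (rule lipschitz_borel_measurable[OF K(2)])
  show ?thesis by (rule \<sigma>.square_integrable_bounded[OF _ K(1)]) measurable
qed

lemma H2_Cauchy_energy_convergent:
  assumes F: "F \<in> H2_Cauchy M \<sigma> d e"
  shows "convergent (\<lambda>n. sqrt (energy M \<sigma> (F n)))"
proof (rule Cauchy_convergent, rule CauchyI)
  fix \<epsilon> :: real assume "\<epsilon> > 0"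
  then obtain N where N: "\<And>m n. m \<ge> N \<Longrightarrow> n \<ge> N \<Longrightarrow> H2_norm M \<sigma> (\<lambda>x. F m x - F n x) < \<epsilon>"
    using F unfolding H2_Cauchy_def by blast
  have FC2: "F n \<in> FC2 d e" for n using F by (simp add: H2_Cauchy_def)
  have "norm (sqrt (energy M \<sigma> (F m)) - sqrt (energy M \<sigma> (F n))) < \<epsilon>" if "m \<ge> N" "n \<ge> N" for m n
    using order.strict_trans1[OF FC2_sqrt_energy_diff_le[OF FC2 FC2] N[OF that]] by simp
  then show "\<exists>N. \<forall>m\<ge>N. \<forall>n\<ge>N. norm (sqrt (energy M \<sigma> (F m)) - sqrt (energy M \<sigma> (F n))) < \<epsilon>" by blast
qed

lemma H2_rel_energy_tendsto:
  assumes rel: "(F, G) \<in> H2_rel M \<sigma> d e" and F: "(\<lambda>n. sqrt (energy M \<sigma> (F n))) \<longlonglongrightarrow> r"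
  shows "(\<lambda>n. sqrt (energy M \<sigma> (G n))) \<longlonglongrightarrow> r"
proof -
  have FG: "F n \<in> FC2 d e" "G n \<in> FC2 d e" for n
    using rel by (simp_all add: H2_rel_def H2_Cauchy_def)
  have "(\<lambda>n. H2_norm M \<sigma> (\<lambda>x. F n x - G n x)) \<longlonglongrightarrow> 0" using rel by (simp add: H2_rel_def)
  then have "(\<lambda>n. sqrt (energy M \<sigma> (F n)) - sqrt (energy M \<sigma> (G n))) \<longlonglongrightarrow> 0"
    by (rule Lim_null_comparison[rotated]) (use FC2_sqrt_energy_diff_le[OF FG] in simp)
  from tendsto_diff[OF F this] show ?thesis by simp
qed

text \<open>The definite description in \<open>H2_energy\<close> requires one limit shared by all
  representatives, which \<open>H2_rel_energy_tendsto\<close> provides; \<open>F\<close> lies in its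
  own class by reflexivity.\<close>

lemma H2_representative:
  assumes "f \<in> H2 M \<sigma> d e"
  obtains F r where "F \<in> f" "\<And>n. F n \<in> FC2 d e"
    "(\<lambda>n. sqrt (energy M \<sigma> (F n))) \<longlonglongrightarrow> r" "H2_energy M \<sigma> f = r\<^sup>2" "r \<ge> 0"
proof -
  from assms obtain F where F: "F \<in> H2_Cauchy M \<sigma> d e" and f: "f = H2_rel M \<sigma> d e `` {F}"
    by (auto simp: H2_def elim: quotientE)
  obtain r where r: "(\<lambda>n. sqrt (energy M \<sigma> (F n))) \<longlonglongrightarrow> r"
    using H2_Cauchy_energy_convergent[OF F] by (auto simp: convergent_def)
  have "H2_norm M \<sigma> (\<lambda>x. F n x - F n x) = 0" for n
    by (simp add: H2_norm_def L2_norm_def energy_def)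
  then have "F \<in> f" using F by (simp add: f H2_rel_def)
  have "(\<lambda>n. energy M \<sigma> (G n)) \<longlonglongrightarrow> r\<^sup>2" if "G \<in> f" for G
    using tendsto_power[OF H2_rel_energy_tendsto[OF _ r], of G d e 2] that energy_nonneg by (simp add: f)
  then have "H2_energy M \<sigma> f = r\<^sup>2"
    unfolding H2_energy_def using \<open>F \<in> f\<close> by (intro the_equality) (auto intro: LIMSEQ_unique)
  moreover have "r \<ge> 0" using energy_nonneg by (intro LIMSEQ_le_const[OF r]) auto
  ultimately show ?thesis using that[OF \<open>F \<in> f\<close> _ r] F by (simp add: H2_Cauchy_def)
qed

end

text \<open>The inequality holds along a representing sequence, and
  \<open>L2_norm_centered_le\<close> compares each centred term with the centred \<open>u\<close> at
  a cost that tends to 0.\<close>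

lemma (in dominated_levy_mehler) poincare_H2:
  assumes f: "f \<in> H2 M \<sigma> d e" and u: "H2_L2 \<sigma> f u"
  shows "L2_norm \<sigma> (\<lambda>x. u x - (LINT z|\<sigma>. u z)) \<le> sqrt C * sqrt (H2_energy M \<sigma> f)"
proof -
  obtain F r where F: "F \<in> f" "\<And>n. F n \<in> FC2 d e"
    and r: "(\<lambda>n. sqrt (energy M \<sigma> (F n))) \<longlonglongrightarrow> r" "H2_energy M \<sigma> f = r\<^sup>2" "r \<ge> 0"
    using H2_representative[OF f] by blast
  have sq: "square_integrable \<sigma> u" "square_integrable \<sigma> (F n)" for n
    using u FC2_square_integrable[OF F(2)] by (simp_all add: H2_L2_def)
  have lim: "(\<lambda>n. L2_norm \<sigma> (\<lambda>x. F n x - u x)) \<longlonglongrightarrow> 0" using u F(1) by (simp add: H2_L2_def)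
  have "L2_norm \<sigma> (\<lambda>x. u x - \<sigma>.expectation u) \<le>
      sqrt C * sqrt (energy M \<sigma> (F n)) + 2 * L2_norm \<sigma> (\<lambda>x. F n x - u x)" for n
  proof -
    have "L2_norm \<sigma> (\<lambda>x. F n x - \<sigma>.expectation (F n)) \<le> sqrt C * sqrt (energy M \<sigma> (F n))"
      unfolding \<sigma>.L2_norm_centered[OF sq(2)] real_sqrt_mult[symmetric]
      by (intro real_sqrt_le_mono poincare_FC2[OF F(2)])
    then show ?thesis using \<sigma>.L2_norm_centered_le[OF sq(2) sq(1), of n] by linarith
  qed
  moreover have "(\<lambda>n. sqrt C * sqrt (energy M \<sigma> (F n)) + 2 * L2_norm \<sigma> (\<lambda>x. F n x - u x))
      \<longlonglongrightarrow> sqrt C * r + 2 * 0"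
    by (intro tendsto_intros r lim)
  ultimately have "L2_norm \<sigma> (\<lambda>x. u x - \<sigma>.expectation u) \<le> sqrt C * r + 2 * 0"
    by (intro LIMSEQ_le_const) auto
  then show ?thesis using r by simp
qed

theorem proposition4p4:
  fixes T :: "real \<Rightarrow> 'a::{real_inner,banach,polish_space} \<Rightarrow> 'a"
    and b :: 'a
    and M :: "'a measure"
    and \<mu> :: "real \<Rightarrow> 'a measure"
    and \<sigma> :: "'a measure"
    and d :: enat
    and e :: "nat \<Rightarrow> 'a"
    and h :: "real \<Rightarrow> real"
    and C :: real
    and f :: "(nat \<Rightarrow> 'a \<Rightarrow> real) set"
    and u :: "'a \<Rightarrow> real"
  assumes "C0_semigroup T"
    and "levy_measure M"
    and "continuous_map sazonov euclidean (levy_symbol b M)"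
    and "mehler_laws T b M \<mu>"
    and "orthonormal_basis_seq d e"
    and "\<forall>n. enat n < d \<longrightarrow> eigenvector (adjoint_graph (generator T)) (e n)"
    and "(\<integral>\<^sup>+x\<in>- ball 0 1. ennreal (norm x) \<partial>M) < \<infinity>"
    and "\<exists>b_inf. (mehler_drift T b M \<longlongrightarrow> b_inf) at_top"
    and "(\<integral>\<^sup>+s\<in>{0..}. (\<integral>\<^sup>+x. ennreal (min 1 ((norm (T s x))\<^sup>2)) \<partial>M) \<partial>lborel) < \<infinity>"
    and "\<forall>x. ((\<lambda>t. T t x) \<longlongrightarrow> 0) at_top"
    and "\<forall>t>0. h t > 0"
    and "set_integrable lebesgue {0<..} h"
    and "\<forall>t>0. positive_measure_difference (scale_measure (ennreal (h t)) M) (distr M borel (T t))"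
    and "invariant_measure (mehler_op T \<mu>) \<sigma>"
    and "C = (LINT t:{0<..}|lebesgue. \<bar>h t\<bar>)"
    and "f \<in> H2 M \<sigma> d e"
    and "H2_L2 \<sigma> f u"
  shows "L2_norm \<sigma> (\<lambda>x. u x - (LINT z|\<sigma>. u z)) \<le> sqrt (2 * C) * sqrt (H2_energy M \<sigma> f)"
proof -
  interpret dominated_levy_mehler T b M \<mu> \<sigma> h C
    using assms by unfold_locales auto
  have "L2_norm \<sigma> (\<lambda>x. u x - (LINT z|\<sigma>. u z)) \<le> sqrt C * sqrt (H2_energy M \<sigma> f)"
    by (rule poincare_H2) fact+
  \<comment> \<open>The factor 2 enters only here, by monotonicity of the root and
    \<open>C \<ge> 0\<close>.\<close>
  also have "\<dots> \<le> sqrt (2 * C) * sqrt (H2_energy M \<sigma> f)"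
  proof (rule mult_right_mono)
    show "sqrt C \<le> sqrt (2 * C)" using C_nonneg by simp
    obtain r where "H2_energy M \<sigma> f = r\<^sup>2" by (rule H2_representative[OF \<open>f \<in> H2 M \<sigma> d e\<close>])
    then show "0 \<le> sqrt (H2_energy M \<sigma> f)" by simp
  qed
  finally show ?thesis .
qed

end
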